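(* Let $h$ be a positive integer. There exist constants $C_h>0$ and $m_0(h)$, depending only on $h$, such that the following holds. Let $\alpha_1,\dots,\alpha_h$ be positive real numbers and let $m\ge m_0(h)$ be an integer. Suppose that $A,B_1,\dots,B_h$ are non-empty finite sets in a commutative group that satisfy $|A|=m$ and $|A+B_i|\le \alpha_i m$ for all $1\le i\le h$. Then $$|A+B_1+\dots+B_h|\;\le\;\frac{\left(1-\frac1h\right)^{h-1}}{h}\,\alpha_1\cdots\alpha_h\left(m^{2-1/h}+C_h\,m^{2-2/h}\right).$$ In particular, $|A+B_1+\dots+B_h|\le (1+o(1))\,\frac{(1-1/h)^{h-1}}{h}\,\alpha_1\cdots\alpha_h\, m^{2-1/h}$, where the $o(1)$ term tends to $0$ as $m\to\infty$ (with $h$ fixed).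
   Context: For non-empty finite sets in a commutative group (written additively), the sumset is $A+B_1+\dots+B_h=\{a+b_1+\dots+b_h: a\in A,\ b_i\in B_i \text{ for } 1\le i\le h\}$, and $|S|$ denotes the cardinality of $S$. For $h=1$ the convention $0^0=1$ is used, so $(1-1/h)^{h-1}=1$. *)

theory Defs
  imports Complex_Main "HOL-Algebra.Coset" "HOL-Algebra.FiniteProduct"
begin

text \<open>
  Commutative groups are \<^locale>\<open>comm_group\<close>s, with an arbitrary carrier set, so the group operation is
  written multiplicatively and the sumset of two sets is the library's \<^const>\<open>set_mult\<close>.
\<close>

definition sumset_family ::
    "('a, 'b) monoid_scheme \<Rightarrow> nat \<Rightarrow> 'a set \<Rightarrow> (nat \<Rightarrow> 'a set) \<Rightarrow> 'a set" where
  "sumset_family G h A B =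
     {a \<otimes>\<^bsub>G\<^esub> finprod G b {1..h} | a b. a \<in> A \<and> (\<forall>i\<in>{1..h}. b i \<in> B i)}"

definition sumset_hyps ::
    "('a, 'b) monoid_scheme \<Rightarrow> nat \<Rightarrow> nat \<Rightarrow> (nat \<Rightarrow> real) \<Rightarrow> 'a set \<Rightarrow> (nat \<Rightarrow> 'a set) \<Rightarrow> bool" where
  "sumset_hyps G h m \<alpha> A B \<longleftrightarrow>
     comm_group G \<and>
     A \<subseteq> carrier G \<and> finite A \<and> A \<noteq> {} \<and>
     (\<forall>i\<in>{1..h}. B i \<subseteq> carrier G \<and> finite (B i) \<and> B i \<noteq> {}) \<and>
     (\<forall>i\<in>{1..h}. \<alpha> i > 0) \<and>
     card A = m \<and>
     (\<forall>i\<in>{1..h}. real (card (A <#>\<^bsub>G\<^esub> B i)) \<le> \<alpha> i * real m)"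

text \<open>
  The type argument only selects the type in which the groups live.  The function \<open>F\<close> is the factor
  of the bound that depends on \<open>m\<close>.  For \<open>h = 1\<close> the power below is \<open>0 ^ 0 = 1\<close>.
\<close>

definition sumset_bound :: "'a itself \<Rightarrow> nat \<Rightarrow> nat \<Rightarrow> (nat \<Rightarrow> real) \<Rightarrow> bool" where
  "sumset_bound T h m\<^sub>0 F \<longleftrightarrow>
     (\<forall>(G :: 'a monoid) m \<alpha> A B. m \<ge> m\<^sub>0 \<longrightarrow> sumset_hyps G h m \<alpha> A B \<longrightarrow>
        real (card (sumset_family G h A B))
          \<le> (1 - 1 / real h) ^ (h - 1) / real h * (\<Prod>i=1..h. \<alpha> i) * F m)"

text \<open>
  HOL cannot quantify over types below an existential quantifier, so a plain statement
  ``there are constants such that all groups over \<open>'a\<close> satisfy the bound'' would let the constants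
  depend on \<open>'a\<close>.  The main statement therefore asserts that constants exist for the groups whose carrier
  is a set of natural numbers (up to isomorphism, all countable groups), and that every bound
  valid for those groups is valid, with the same constants, for the groups over an
  arbitrary type \<open>'a\<close>.
\<close>

end

theory Submission
  imports Defs "HOL-Algebra.Product_Groups" "HOL-Library.Countable_Set"
begin

text \<open>
  Products of sets are written by juxtaposition, \<open>S\<close> is the product of \<open>B 1, \<dots>, B h\<close>, and \<open>P\<close> is the
  product of the \<open>\<alpha> i\<close>.

  Measure a subset \<open>X\<close> of \<open>A\<close> by the average over \<open>i\<close> of \<open>|X B i - Y B i| / \<alpha> i\<close>, where \<open>Y\<close> is
  the part of \<open>A\<close> treated before, and call the quotient of this average by \<open>|X|\<close> the ratio of \<open>X\<close>.
  Split \<open>A\<close> greedily into pieces of minimal ratio.  A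
  relative form of Pluennecke's inequality for different summands shows that a piece \<open>X\<close> of ratio \<open>\<rho>\<close>
  contributes at most \<open>P \<rho>^h |X|\<close> new elements to \<open>AS\<close> (\<open>tight_set_growth\<close>).  The ratios, weighted by
  the sizes of the pieces, add up to at most \<open>m\<close>.

  Alone this is not enough, since a small piece may have a huge ratio.  But every element of \<open>A\<close>
  contributes at most \<open>|S|\<close> elements, and the first piece, of ratio \<open>\<beta>\<close>, shows
  \<open>|S| \<le> P \<beta>^h m\<close>.  Hence an element of ratio \<open>\<rho>\<close> costs at most \<open>P min(\<rho>^h, \<beta>^h m)\<close> with
  \<open>\<rho> \<ge> \<beta>\<close>.  By convexity the extremal distribution of ratios uses only the values \<open>\<beta>\<close> and
  \<open>\<beta> m^(1/h)\<close>, which gives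
  \<open>|AS| \<le> P m (1 + (1 - \<beta>) \<beta>^(h-1) (1 + M + \<dots> + M^(h-1)))\<close> with \<open>M = m^(1/h)\<close>
  (\<open>new_products_bound\<close>, \<open>product_set_bound\<close>).  Maximising over \<open>\<beta>\<close> produces the constant \<open>(1 - 1/h)^(h-1) / h\<close>
  (\<open>interior_maximum\<close>), the term \<open>M^(h-1)\<close> is the main term, and the others go into the error.

  Pluennecke's inequality itself (\<open>plunnecke_distinct_summands\<close>) is first proved up to the factor \<open>h^h\<close> by
  Petridis's method (\<open>extremal_set_growth\<close>).  Minimal expansion ratios are multiplicative in
  Cartesian powers, so applying the weak form in high powers of the group removes the factor.

  The transfer from groups of natural numbers to all groups holds because finitely many elements
  generate a countable group.
\<close>

section \<open>Product sets\<close>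

lemma finite_set_mult:
  assumes "finite A" "finite B"
  shows "finite (A <#>\<^bsub>G\<^esub> B)"
  using assms by (simp add: set_mult_def)

lemma set_mult_Un_left: "(A \<union> A') <#>\<^bsub>G\<^esub> B = (A <#>\<^bsub>G\<^esub> B) \<union> (A' <#>\<^bsub>G\<^esub> B)"
  by (auto simp: set_mult_def)

lemma set_mult_empty [simp]: "{} <#>\<^bsub>G\<^esub> B = {}" "A <#>\<^bsub>G\<^esub> {} = {}"
  by (auto simp: set_mult_def)

lemma in_set_multI: "a \<in> A \<Longrightarrow> b \<in> B \<Longrightarrow> a \<otimes>\<^bsub>G\<^esub> b \<in> A <#>\<^bsub>G\<^esub> B"
  by (auto simp: set_mult_def)

lemma in_set_multE:
  assumes "x \<in> A <#>\<^bsub>G\<^esub> B"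
  obtains a b where "a \<in> A" "b \<in> B" "x = a \<otimes>\<^bsub>G\<^esub> b"
  using assms by (auto simp: set_mult_def)

section \<open>Growth of extremal sets\<close>

text \<open>
  The count behind one step of Petridis's induction.  If adding the translate \<open>Zc\<close> produces a set \<open>V\<close>
  of new elements of \<open>ZcB\<close>, then everything coming from \<open>Wc\<close> or \<open>Yc\<close> is lost, and undoing the
  translation embeds \<open>V\<close> into \<open>ZB - YB\<close> without \<open>WB\<close>.
\<close>
lemma (in comm_group) card_translate_new_le:
  assumes carr: "Z \<subseteq> carrier G" "Y \<subseteq> carrier G" "B \<subseteq> carrier G" "c \<in> carrier G" "W \<subseteq> Z"
    and fin: "finite Z" "finite B"
    and sub: "V \<subseteq> (Z <#> {c}) <#> B"
    and W: "V \<inter> ((W <#> {c}) <#> B) = {}" and Y: "V \<inter> ((Y <#> {c}) <#> B) = {}"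
  shows "card V + card ((W <#> B) - (Y <#> B)) \<le> card ((Z <#> B) - (Y <#> B))"
proof -
  let ?N = "(Z <#> B) - (Y <#> B)" and ?N' = "(W <#> B) - (Y <#> B)"
  have sh: "(U <#> {c}) <#> B = (\<lambda>x. c \<otimes> x) ` (U <#> B)" if "U \<subseteq> carrier G" for U
  proof -
    have "(a \<otimes> c) \<otimes> b = c \<otimes> (a \<otimes> b)" if "a \<in> U" "b \<in> B" for a b
      using that \<open>U \<subseteq> carrier G\<close> carr by (simp add: m_ac subset_iff)
    then show ?thesis by (force simp: set_mult_def)
  qed
  have finZ: "finite ?N" using fin by (simp add: finite_set_mult)
  have "W \<subseteq> carrier G" using carr by auto
  then have "V \<subseteq> (\<lambda>x. c \<otimes> x) ` (?N - ?N')"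
  proof (intro subsetI)
    fix x assume "x \<in> V"
    then have "x \<in> (\<otimes>) c ` (Z <#> B)" "x \<notin> (\<otimes>) c ` (W <#> B)" "x \<notin> (\<otimes>) c ` (Y <#> B)"
      using sub W Y \<open>W \<subseteq> carrier G\<close> by (auto simp: sh carr)
    then show "x \<in> (\<lambda>x. c \<otimes> x) ` (?N - ?N')" by blast
  qed
  then have "card V \<le> card (?N - ?N')"
    by (meson card_image_le card_mono finZ finite_Diff finite_imageI order_trans)
  moreover have "?N' \<subseteq> ?N" using mono_set_mult[OF \<open>W \<subseteq> Z\<close> subset_refl[of B]] by auto
  ultimately show ?thesis
    using finZ by (simp add: card_Diff_subset finite_subset card_mono le_diff_conv2)
qed

text \<open>
  Petridis's lemma, relative to a removed set and for several sets \<open>B i\<close> at once.  Call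
  \<open>g(W) = (\<Sum>i. w i * |W B i - Y B i|)\<close> the weighted expansion of \<open>W\<close>.  When \<open>Z\<close> minimises
  \<open>g(W) / |W|\<close> among its own subsets, multiplying \<open>Z\<close> by an arbitrary set \<open>C\<close> first does not increase
  the expansion ratio.

  The induction adds one element \<open>c\<close> to \<open>C\<close>.  Let \<open>W\<close> be the part of \<open>Z\<close> whose translate by \<open>c\<close>
  was already present.  The set grows by exactly \<open>|Z| - |W|\<close>, while the expansion grows by at most
  \<open>g(Z) - g(W)\<close>, which is at most \<open>K (|Z| - |W|)\<close> by minimality.

  The removed set is an arbitrary \<open>Q\<close> above \<open>Y C\<close> rather than \<open>Y C\<close> itself: the latter grows with \<open>C\<close>,
  and the induction hypothesis is needed for the removed set of the next stage.
\<close>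
lemma (in comm_group) extremal_set_growth:
  fixes w :: "'i \<Rightarrow> real" and K :: real
  assumes fin: "finite I" "finite Z" "finite Y" "\<And>i. i \<in> I \<Longrightarrow> finite (B i)"
    and carr: "Z \<subseteq> carrier G" "Y \<subseteq> carrier G" "\<And>i. i \<in> I \<Longrightarrow> B i \<subseteq> carrier G"
    and w: "\<And>i. i \<in> I \<Longrightarrow> 0 \<le> w i"
    and min: "\<And>W. W \<subseteq> Z \<Longrightarrow> K * real (card W) \<le> (\<Sum>i\<in>I. w i * card ((W <#> B i) - (Y <#> B i)))"
    and tight: "(\<Sum>i\<in>I. w i * card ((Z <#> B i) - (Y <#> B i))) \<le> K * real (card Z)"
    and C: "finite C" "C \<subseteq> carrier G"
    and Q: "Y <#> C \<subseteq> Q"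
  shows "(\<Sum>i\<in>I. w i * card (((Z <#> C) <#> B i) - (Q <#> B i))) \<le> K * real (card ((Z <#> C) - Q))"
  using C Q
proof (induction C rule: finite_induct)
  case empty
  then show ?case by simp
next
  case (insert c C)
  have c: "c \<in> carrier G" and C: "C \<subseteq> carrier G" using insert.prems by auto
  have split: "U <#> insert c C = (U <#> C) \<union> (U <#> {c})" for U
    by (auto simp: set_mult_def)
  have QC: "Y <#> C \<subseteq> Q" and Qc: "Y <#> {c} \<subseteq> Q" using insert.prems unfolding split by auto
  define W where "W = {z \<in> Z. z \<otimes> c \<in> (Z <#> C) \<union> Q}"
  have WZ: "W \<subseteq> Z" by (auto simp: W_def)
  have Wc: "W <#> {c} \<subseteq> (Z <#> C) \<union> Q" by (auto simp: W_def set_mult_def)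
  define V where "V i = ((Z <#> {c}) <#> B i) - ((Q <#> B i) \<union> ((Z <#> C) <#> B i))" for i
  let ?n = "\<lambda>U i. card ((U <#> B i) - (Y <#> B i))"
  have V: "card (V i) + ?n W i \<le> ?n Z i" if i: "i \<in> I" for i
  proof (rule card_translate_new_le)
    show "V i \<inter> ((W <#> {c}) <#> B i) = {}"
      using mono_set_mult[OF Wc subset_refl[of "B i"]] by (auto simp: V_def set_mult_Un_left)
    show "V i \<inter> ((Y <#> {c}) <#> B i) = {}"
      using mono_set_mult[OF Qc subset_refl[of "B i"]] by (auto simp: V_def)
  qed (use carr c fin WZ i in \<open>auto simp: V_def\<close>)
  have le: "card (((Z <#> insert c C) <#> B i) - (Q <#> B i))
      \<le> card (((Z <#> C) <#> B i) - (Q <#> B i)) + card (V i)" if "i \<in> I" for i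
  proof -
    have "((Z <#> insert c C) <#> B i) - (Q <#> B i) \<subseteq> (((Z <#> C) <#> B i) - (Q <#> B i)) \<union> V i"
      by (auto simp: V_def split set_mult_Un_left)
    moreover have "finite ((((Z <#> C) <#> B i) - (Q <#> B i)) \<union> V i)"
      using fin insert.hyps that by (auto simp: V_def finite_set_mult)
    ultimately show ?thesis by (meson card_Un_le card_mono order_trans)
  qed
  have eq: "card ((Z <#> insert c C) - Q) = card ((Z <#> C) - Q) + card (Z - W)"
  proof -
    have "(Z <#> insert c C) - Q = ((Z <#> C) - Q) \<union> (\<lambda>z. z \<otimes> c) ` (Z - W)"
      by (auto simp: split W_def set_mult_def)
    moreover have "((Z <#> C) - Q) \<inter> (\<lambda>z. z \<otimes> c) ` (Z - W) = {}"
      by (auto simp: W_def)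
    moreover have "inj_on (\<lambda>z. z \<otimes> c) (Z - W)"
      using carr c by (intro inj_onI) (auto simp: subset_iff)
    ultimately show ?thesis
      using fin insert.hyps by (simp add: card_Un_disjoint card_image finite_set_mult)
  qed
  have cardZ: "card (Z - W) = card Z - card W" "card W \<le> card Z"
    using WZ fin by (auto simp: card_Diff_subset finite_subset card_mono)
  have "(\<Sum>i\<in>I. w i * card (((Z <#> insert c C) <#> B i) - (Q <#> B i)))
      \<le> (\<Sum>i\<in>I. w i * (card (((Z <#> C) <#> B i) - (Q <#> B i)) + (real (?n Z i) - ?n W i)))"
  proof (intro sum_mono mult_left_mono w)
    fix i assume "i \<in> I"
    then show "real (card (((Z <#> insert c C) <#> B i) - (Q <#> B i)))
        \<le> card (((Z <#> C) <#> B i) - (Q <#> B i)) + (real (?n Z i) - ?n W i)"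
      using V[of i] le[of i] by linarith
  qed
  also have "\<dots> = (\<Sum>i\<in>I. w i * card (((Z <#> C) <#> B i) - (Q <#> B i)))
      + ((\<Sum>i\<in>I. w i * ?n Z i) - (\<Sum>i\<in>I. w i * ?n W i))"
    by (simp add: algebra_simps sum.distrib sum_subtractf)
  also have "\<dots> \<le> K * card ((Z <#> C) - Q) + (K * card Z - K * card W)"
    using insert.IH[OF C QC] tight min[OF WZ] by linarith
  also have "\<dots> = K * card ((Z <#> insert c C) - Q)"
    unfolding eq cardZ(1) using cardZ(2) by (simp add: algebra_simps of_nat_diff)
  finally show ?case .
qed

section \<open>Iterated products\<close>

text \<open>
  Recursion on the number of factors lets the growth estimates be applied to one factor at a time.
\<close>
primrec prodset :: "('a, 'b) monoid_scheme \<Rightarrow> (nat \<Rightarrow> 'a set) \<Rightarrow> nat \<Rightarrow> 'a set" where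
  "prodset G B 0 = {\<one>\<^bsub>G\<^esub>}"
| "prodset G B (Suc n) = prodset G B n <#>\<^bsub>G\<^esub> B (Suc n)"

lemma (in comm_group) prodset_carrier:
  assumes "\<And>i. i \<in> {1..n} \<Longrightarrow> B i \<subseteq> carrier G"
  shows "prodset G B n \<subseteq> carrier G"
  using assms
proof (induction n)
  case (Suc n)
  have "prodset G B n \<subseteq> carrier G" by (rule Suc.IH, rule Suc.prems) auto
  moreover have "B (Suc n) \<subseteq> carrier G" by (rule Suc.prems) auto
  ultimately show ?case by (simp add: set_mult_closed)
qed simp

lemma finite_prodset:
  assumes "\<And>i. i \<in> {1..n} \<Longrightarrow> finite (B i)"
  shows "finite (prodset G B n)"
  using assms by (induction n) (auto intro!: finite_set_mult)

lemma (in comm_group) prodset_eq: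
  assumes "\<And>i. i \<in> {1..n} \<Longrightarrow> B i \<subseteq> carrier G"
  shows "prodset G B n = {finprod G b {1..n} | b. \<forall>i\<in>{1..n}. b i \<in> B i}"
  using assms
proof (induction n)
  case 0
  then show ?case by simp
next
  case (Suc n)
  have IH: "prodset G B n = {finprod G b {1..n} | b. \<forall>i\<in>{1..n}. b i \<in> B i}"
    using Suc by auto
  have ins: "{1..Suc n} = insert (Suc n) {1..n}" by auto
  have step: "finprod G b {1..Suc n} = finprod G b {1..n} \<otimes> b (Suc n)"
    if b: "\<forall>i\<in>{1..Suc n}. b i \<in> B i" for b
  proof -
    have *: "b \<in> {1..n} \<rightarrow> carrier G" "b (Suc n) \<in> carrier G"
    proof -
      have "b i \<in> carrier G" if "i \<in> {1..Suc n}" for i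
        using b Suc.prems[OF that] that by blast
      then show "b \<in> {1..n} \<rightarrow> carrier G" "b (Suc n) \<in> carrier G" by auto
    qed
    show ?thesis unfolding ins using * by (simp add: m_comm)
  qed
  show ?case
  proof (intro equalityI subsetI)
    fix x assume "x \<in> prodset G B (Suc n)"
    then obtain b y where b: "\<forall>i\<in>{1..n}. b i \<in> B i" "y \<in> B (Suc n)" "x = finprod G b {1..n} \<otimes> y"
      by (auto simp: IH elim!: in_set_multE)
    let ?b = "b(Suc n := y)"
    have b': "\<forall>i\<in>{1..Suc n}. ?b i \<in> B i" using b by auto
    have "finprod G ?b {1..n} = finprod G b {1..n}"
    proof (rule finprod_cong')
      show "b \<in> {1..n} \<rightarrow> carrier G"
      proof
        fix i assume "i \<in> {1..n}"
        then have "b i \<in> B i" "i \<in> {1..Suc n}" using b by auto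
        then show "b i \<in> carrier G" using Suc.prems by blast
      qed
    qed auto
    then have "x = finprod G ?b {1..Suc n}"
      unfolding step[OF b'] by (simp only: b(3) fun_upd_same)
    then show "x \<in> {finprod G b {1..Suc n} | b. \<forall>i\<in>{1..Suc n}. b i \<in> B i}" using b' by blast
  next
    fix x assume "x \<in> {finprod G b {1..Suc n} | b. \<forall>i\<in>{1..Suc n}. b i \<in> B i}"
    then obtain b where b: "\<forall>i\<in>{1..Suc n}. b i \<in> B i" "x = finprod G b {1..Suc n}" by auto
    then show "x \<in> prodset G B (Suc n)" unfolding b(2) step[OF b(1)] prodset.simps IH
      by (intro in_set_multI) auto
  qed
qed

lemma (in comm_group) sumset_family_eq:
  assumes "\<And>i. i \<in> {1..h} \<Longrightarrow> B i \<subseteq> carrier G"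
  shows "sumset_family G h A B = A <#> prodset G B h"
proof -
  have "prodset G B h = {finprod G b {1..h} | b. \<forall>i\<in>{1..h}. b i \<in> B i}"
    using assms by (rule prodset_eq)
  then have P: "x \<in> prodset G B h \<longleftrightarrow> (\<exists>b. x = finprod G b {1..h} \<and> (\<forall>i\<in>{1..h}. b i \<in> B i))" for x
    by blast
  show ?thesis
  proof (intro equalityI subsetI)
    fix x assume "x \<in> sumset_family G h A B"
    then obtain a b where "a \<in> A" "\<forall>i\<in>{1..h}. b i \<in> B i" "x = a \<otimes> finprod G b {1..h}"
      unfolding sumset_family_def by blast
    then show "x \<in> A <#> prodset G B h" using P by (metis in_set_multI)
  next
    fix x assume "x \<in> A <#> prodset G B h"
    then obtain a y where "a \<in> A" "y \<in> prodset G B h" "x = a \<otimes> y" by (rule in_set_multE)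
    moreover from this(2) obtain b where "y = finprod G b {1..h}" "\<forall>i\<in>{1..h}. b i \<in> B i"
      unfolding P by blast
    ultimately show "x \<in> sumset_family G h A B" unfolding sumset_family_def by blast
  qed
qed

section \<open>Pluennecke's inequality for different summands\<close>

lemma exists_min_ratio_subset:
  fixes g :: "'a set \<Rightarrow> real"
  assumes "finite X" "X \<noteq> {}" "g {} = 0"
  obtains Z where "Z \<subseteq> X" "Z \<noteq> {}"
    "\<And>W. W \<subseteq> X \<Longrightarrow> g Z / card Z * card W \<le> g W"
proof -
  let ?S = "Pow X - {{}}"
  have "finite ?S" "?S \<noteq> {}" using assms by auto
  then obtain Z where "is_arg_min (\<lambda>W. g W / card W) (\<lambda>W. W \<in> ?S) Z"
    using ex_is_arg_min_if_finite[of ?S "\<lambda>W. g W / card W"] by blast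
  then have Z: "Z \<in> ?S" "\<And>W. W \<in> ?S \<Longrightarrow> g Z / card Z \<le> g W / card W"
    by (auto simp: is_arg_min_linorder)
  show ?thesis
  proof (rule that)
    fix W assume "W \<subseteq> X"
    show "g Z / card Z * card W \<le> g W"
    proof (cases "W = {}")
      case False
      then have "card W > 0" using \<open>W \<subseteq> X\<close> assms by (auto simp: card_gt_0_iff finite_subset)
      moreover have "g Z / card Z \<le> g W / card W" using Z(2) False \<open>W \<subseteq> X\<close> by auto
      ultimately show ?thesis by (simp add: pos_le_divide_eq)
    qed (simp add: assms)
  qed (use Z in auto)
qed

text \<open>
  Let \<open>r i\<close> be the expansion ratio of \<open>X\<close> under \<open>B i\<close>.  With weights \<open>1 / r i\<close> the whole of \<open>X\<close> has
  weighted expansion ratio \<open>h\<close>, so the minimiser \<open>Z\<close> has ratio at most \<open>h\<close>, and so do all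
  products of \<open>Z\<close> with further sets.  Keeping a single summand at each of \<open>h\<close> steps costs the factor \<open>h ^ h\<close>; the
  passage to Cartesian powers below removes it.
\<close>
lemma (in comm_group) plunnecke_with_constant:
  assumes fin: "finite X" "finite Y" "\<And>i. i \<in> {1..h} \<Longrightarrow> finite (B i)"
    and carr: "X \<subseteq> carrier G" "Y \<subseteq> carrier G" "\<And>i. i \<in> {1..h} \<Longrightarrow> B i \<subseteq> carrier G"
    and "X \<noteq> {}"
    and pos: "\<And>i. i \<in> {1..h} \<Longrightarrow> card ((X <#> B i) - (Y <#> B i)) > 0"
  obtains Z where "Z \<subseteq> X" "Z \<noteq> {}"
    "real (card ((Z <#> prodset G B h) - (Y <#> prodset G B h)))
      \<le> real h ^ h * (\<Prod>i=1..h. card ((X <#> B i) - (Y <#> B i)) / real (card X)) * card Z"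
proof -
  define r where "r i = card ((X <#> B i) - (Y <#> B i)) / real (card X)" for i
  have cX: "card X > 0" using fin \<open>X \<noteq> {}\<close> by (simp add: card_gt_0_iff)
  have r: "r i > 0" if "i \<in> {1..h}" for i using pos[OF that] cX by (simp add: r_def)
  define g where "g W = (\<Sum>i\<in>{1..h}. 1 / r i * card ((W <#> B i) - (Y <#> B i)))" for W
  have "g {} = 0" by (simp add: g_def)
  then obtain Z where Z: "Z \<subseteq> X" "Z \<noteq> {}" "\<And>W. W \<subseteq> X \<Longrightarrow> g Z / card Z * card W \<le> g W"
    using exists_min_ratio_subset[of X g] fin \<open>X \<noteq> {}\<close> by blast
  define K where "K = g Z / card Z"
  have K0: "K \<ge> 0" unfolding K_def g_def
    by (intro divide_nonneg_nonneg sum_nonneg mult_nonneg_nonneg) (auto simp: r less_imp_le)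
  have finZ: "finite Z" and carrZ: "Z \<subseteq> carrier G" using Z fin carr by (auto intro: finite_subset)
  have cZ: "card Z > 0" using Z finZ by (simp add: card_gt_0_iff)
  have "K * card X \<le> g X" using Z(3)[of X] by (simp add: K_def)
  also have "g X = (\<Sum>i\<in>{1..h}. real (card X))"
    unfolding g_def
  proof (rule sum.cong)
    fix i assume "i \<in> {1..h}"
    then show "1 / r i * card ((X <#> B i) - (Y <#> B i)) = card X"
      using pos[of i] cX by (auto simp: r_def)
  qed simp
  finally have Kh: "K \<le> h" using cX by simp
  have growth: "(\<Sum>i\<in>{1..h}. 1 / r i * card (((Z <#> C) <#> B i) - ((Y <#> C) <#> B i)))
      \<le> K * real (card ((Z <#> C) - (Y <#> C)))" if "finite C" "C \<subseteq> carrier G" for C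
  proof (rule extremal_set_growth[where w = "\<lambda>i. 1 / r i"])
    show "K * card W \<le> (\<Sum>i\<in>{1..h}. 1 / r i * card ((W <#> B i) - (Y <#> B i)))" if "W \<subseteq> Z" for W
      using Z(3)[of W] Z(1) that by (auto simp: K_def g_def)
    show "(\<Sum>i\<in>{1..h}. 1 / r i * card ((Z <#> B i) - (Y <#> B i))) \<le> K * card Z"
      using cZ by (simp add: K_def g_def)
  qed (use that fin carr finZ carrZ r in \<open>auto simp: less_imp_le\<close>)
  have "real (card ((Z <#> prodset G B n) - (Y <#> prodset G B n))) \<le> h ^ n * (\<Prod>i=1..n. r i) * card Z"
    if "n \<le> h" for n
    using that
  proof (induction n)
    case 0
    have "U <#> {\<one>} = U" if "U \<subseteq> carrier G" for U
      using that by (force simp: set_mult_def)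
    then have "card ((Z <#> {\<one>}) - (Y <#> {\<one>})) \<le> card Z"
      using carr carrZ finZ by (simp add: card_mono)
    then show ?case by simp
  next
    case (Suc n)
    let ?C = "prodset G B n"
    have "i \<in> {1..h}" if "i \<in> {1..n}" for i using that Suc.prems by auto
    then have C: "finite ?C" "?C \<subseteq> carrier G"
      by (meson finite_prodset fin(3), meson prodset_carrier carr(3))
    have i: "Suc n \<in> {1..h}" using Suc.prems by auto
    have assoc: "U <#> prodset G B (Suc n) = (U <#> ?C) <#> B (Suc n)" if "U \<subseteq> carrier G" for U
      using set_mult_assoc[OF that C(2) carr(3)[OF i]] by simp
    let ?N = "card ((Z <#> prodset G B (Suc n)) - (Y <#> prodset G B (Suc n)))"
    have "1 / r (Suc n) * ?N
      \<le> (\<Sum>i\<in>{1..h}. 1 / r i * card (((Z <#> ?C) <#> B i) - ((Y <#> ?C) <#> B i)))"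
      unfolding assoc[OF carrZ] assoc[OF carr(2)]
      using i r by (intro member_le_sum) (auto simp: less_imp_le)
    also have "\<dots> \<le> K * card ((Z <#> ?C) - (Y <#> ?C))" by (rule growth[OF C])
    also have "\<dots> \<le> h * (h ^ n * (\<Prod>i=1..n. r i) * card Z)"
      using Suc K0 Kh by (intro mult_mono) auto
    finally have "?N \<le> r (Suc n) * (h * (h ^ n * (\<Prod>i=1..n. r i) * card Z))"
      using r[OF i] by (simp add: field_simps)
    then show ?case by (simp add: mult_ac)
  qed
  from this[of h] show ?thesis using Z by (intro that[of Z]) (auto simp: r_def)
qed

text \<open>
  If a relation \<open>R\<close> expands subsets of \<open>X\<close> by the factor \<open>\<mu>\<close>, then applying \<open>R\<close> to one coordinate of
  a set of tuples expands that set by \<open>\<mu>\<close> as well: apply the hypothesis in each fibre over the remaining coordinates.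
\<close>
lemma card_replace_coordinate_ge:
  fixes R :: "('a \<times> 'a) set" and Z :: "('i \<Rightarrow> 'a) set" and \<mu> :: real
  assumes fin: "finite Z" "finite (R `` X)"
    and ratio: "\<And>W. W \<subseteq> X \<Longrightarrow> \<mu> * real (card W) \<le> real (card (R `` W))"
    and ZX: "\<And>z. z \<in> Z \<Longrightarrow> z j \<in> X"
  defines "Z' \<equiv> {z(j := y) | z y. z \<in> Z \<and> (z j, y) \<in> R}"
  shows "finite Z'" "\<mu> * real (card Z) \<le> real (card Z')"
proof -
  \<comment> \<open>Resetting coordinate \<open>j\<close> to a default value names the fibres.\<close>
  define base where "base = (\<lambda>z. z(j := undefined)) ` Z"
  define fibre where "fibre b = {x. b(j := x) \<in> Z}" for b
  define put where "put = (\<lambda>(b :: 'i \<Rightarrow> 'a, x). b(j := x))"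
  have fin_base: "finite base" using fin by (simp add: base_def)
  have fibreX: "fibre b \<subseteq> X" for b
    using ZX by (fastforce simp: fibre_def)
  have fin_fibre: "finite (fibre b)" for b
  proof -
    have "fibre b \<subseteq> (\<lambda>z. z j) ` Z"
    proof
      fix x assume "x \<in> fibre b"
      then show "x \<in> (\<lambda>z. z j) ` Z"
        by (intro image_eqI[of _ _ "b(j := x)"]) (auto simp: fibre_def)
    qed
    then show ?thesis using fin by (meson finite_imageI finite_subset)
  qed
  have fin_R: "finite (R `` fibre b)" for b
    by (rule finite_subset[OF _ fin(2)]) (use fibreX in blast)
  have inj: "inj_on put (Sigma base F)" for F
  proof (rule inj_onI, clarsimp simp: put_def)
    fix b x b' x' assume "b \<in> base" "b' \<in> base" and eq: "b(j := x) = b'(j := x')"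
    have "b = (b(j := x))(j := undefined)" "b' = (b'(j := x'))(j := undefined)"
      using \<open>b \<in> base\<close> \<open>b' \<in> base\<close> by (auto simp: base_def)
    then show "b = b' \<and> x = x'" using eq by (metis fun_upd_same)
  qed
  have Z_eq: "Z = put ` Sigma base fibre"
  proof (intro equalityI subsetI)
    fix z assume "z \<in> Z"
    then show "z \<in> put ` Sigma base fibre"
      by (intro image_eqI[of _ _ "(z(j := undefined), z j)"]) (auto simp: put_def base_def fibre_def)
  qed (auto simp: put_def fibre_def)
  have Z'_eq: "Z' = put ` Sigma base (\<lambda>b. R `` fibre b)"
  proof (intro equalityI subsetI)
    fix v assume "v \<in> Z'"
    then obtain z y where "z \<in> Z" "(z j, y) \<in> R" "v = z(j := y)" by (auto simp: Z'_def)
    then show "v \<in> put ` Sigma base (\<lambda>b. R `` fibre b)"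
      by (intro image_eqI[of _ _ "(z(j := undefined), y)"])
        (auto simp: put_def base_def fibre_def intro!: ImageI[of "z j"])
  next
    fix v assume "v \<in> put ` Sigma base (\<lambda>b. R `` fibre b)"
    then obtain b x y where "b(j := x) \<in> Z" "(x, y) \<in> R" "v = b(j := y)"
      by (auto simp: put_def fibre_def)
    then show "v \<in> Z'" unfolding Z'_def by (intro CollectI exI[of _ "b(j := x)"] exI[of _ y]) auto
  qed
  show "finite Z'" unfolding Z'_eq by (intro finite_imageI finite_SigmaI fin_base fin_R)
  have "\<mu> * real (card Z) = (\<Sum>b\<in>base. \<mu> * real (card (fibre b)))"
    by (simp add: Z_eq card_image[OF inj] card_SigmaI fin_base fin_fibre sum_distrib_left)
  also have "\<dots> \<le> (\<Sum>b\<in>base. real (card (R `` fibre b)))"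
    by (intro sum_mono ratio fibreX)
  also have "\<dots> = real (card Z')"
    by (simp add: Z'_eq card_image[OF inj] card_SigmaI fin_base fin_R)
  finally show "\<mu> * real (card Z) \<le> real (card Z')" .
qed

text \<open>
  Minimal expansion ratios are multiplicative under Cartesian powers.  This is the half of that fact in
  which a small-expansion set in the power yields one in the base.  The coordinates are replaced
  one after another, so the intermediate sets \<open>N j\<close> consist of tuples that are already images in the
  first \<open>j\<close> places.
\<close>
lemma card_power_relation_ge:
  fixes R :: "('a \<times> 'a) set" and Z :: "(nat \<Rightarrow> 'a) set" and \<mu> :: real
  assumes fin: "finite Z" "finite (R `` X)"
    and ratio: "\<And>W. W \<subseteq> X \<Longrightarrow> \<mu> * real (card W) \<le> real (card (R `` W))" and "\<mu> \<ge> 0"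
    and ZX: "\<And>z i. z \<in> Z \<Longrightarrow> i < k \<Longrightarrow> z i \<in> X"
  shows "\<mu> ^ k * real (card Z)
    \<le> real (card {v. \<exists>z\<in>Z. (\<forall>i<k. (z i, v i) \<in> R) \<and> (\<forall>i\<ge>k. v i = z i)})"
proof -
  define N where "N j = {v. \<exists>z\<in>Z. (\<forall>i<j. (z i, v i) \<in> R) \<and> (\<forall>i\<ge>j. v i = z i)}" for j :: nat
  have "finite (N j) \<and> \<mu> ^ j * real (card Z) \<le> real (card (N j))" if "j \<le> k" for j
    using that
  proof (induction j)
    case 0
    have "N 0 = Z" by (auto simp: N_def fun_eq_iff[symmetric])
    then show ?case using fin by simp
  next
    case (Suc j)
    have N_Suc: "N (Suc j) = {v(j := y) | v y. v \<in> N j \<and> (v j, y) \<in> R}"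
    proof (intro equalityI subsetI)
      fix v assume "v \<in> N (Suc j)"
      then obtain z where z: "z \<in> Z" "\<forall>i<Suc j. (z i, v i) \<in> R" "\<forall>i\<ge>Suc j. v i = z i"
        by (auto simp: N_def)
      have "v(j := z j) \<in> N j" unfolding N_def using z by (auto intro!: bexI[of _ z])
      then show "v \<in> {v(j := y) | v y. v \<in> N j \<and> (v j, y) \<in> R}"
        using z by (intro CollectI exI[of _ "v(j := z j)"] exI[of _ "v j"]) auto
    next
      fix v assume "v \<in> {v(j := y) | v y. v \<in> N j \<and> (v j, y) \<in> R}"
      then obtain u y z where "v = u(j := y)" "(u j, y) \<in> R" "z \<in> Z"
        "\<forall>i<j. (z i, u i) \<in> R" "\<forall>i\<ge>j. u i = z i" by (auto simp: N_def)
      then show "v \<in> N (Suc j)" unfolding N_def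
        by (auto intro!: bexI[of _ z] simp: less_Suc_eq)
    qed
    have X: "v j \<in> X" if "v \<in> N j" for v using that ZX Suc.prems by (auto simp: N_def)
    have "finite (N j)" and IH: "\<mu> ^ j * real (card Z) \<le> real (card (N j))"
      using Suc by auto
    have step: "finite (N (Suc j))" "\<mu> * real (card (N j)) \<le> real (card (N (Suc j)))"
      unfolding N_Suc using card_replace_coordinate_ge[of "N j" R X \<mu> j] \<open>finite (N j)\<close> fin(2) ratio X
      by blast+
    have "\<mu> ^ Suc j * real (card Z) \<le> \<mu> * real (card (N j))"
      using mult_left_mono[OF IH \<open>\<mu> \<ge> 0\<close>] by (simp add: mult_ac)
    also have "\<dots> \<le> real (card (N (Suc j)))" by (rule step)
    finally show ?case using step(1) by simp
  qed
  from this[of k] show ?thesis by (simp add: N_def)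
qed

lemma (in comm_group) comm_group_product_group: "comm_group (product_group I (\<lambda>_. G))"
proof -
  have "group (product_group I (\<lambda>_. G))" by simp
  moreover have "x \<otimes>\<^bsub>product_group I (\<lambda>_. G)\<^esub> y = y \<otimes>\<^bsub>product_group I (\<lambda>_. G)\<^esub> x"
    if "x \<in> carrier (product_group I (\<lambda>_. G))" "y \<in> carrier (product_group I (\<lambda>_. G))" for x y
    using that by (auto intro!: restrict_ext simp: m_comm PiE_iff)
  ultimately show ?thesis by (rule group.group_comm_groupI)
qed

lemma set_mult_PiE:
  "(PiE I (\<lambda>_. A)) <#>\<^bsub>product_group I (\<lambda>_. G)\<^esub> (PiE I (\<lambda>_. B)) = PiE I (\<lambda>_. A <#>\<^bsub>G\<^esub> B)"
  (is "?L = ?R")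
proof (intro equalityI subsetI)
  fix v assume "v \<in> ?L"
  then show "v \<in> ?R" by (auto elim!: in_set_multE intro!: in_set_multI simp: PiE_iff)
next
  fix v assume v: "v \<in> ?R"
  then have "\<forall>i\<in>I. \<exists>a b. a \<in> A \<and> b \<in> B \<and> v i = a \<otimes>\<^bsub>G\<^esub> b"
    by (fastforce simp: PiE_iff set_mult_def)
  then obtain a b where ab: "\<And>i. i \<in> I \<Longrightarrow> a i \<in> A \<and> b i \<in> B \<and> v i = a i \<otimes>\<^bsub>G\<^esub> b i"
    by metis
  have "v = restrict a I \<otimes>\<^bsub>product_group I (\<lambda>_. G)\<^esub> restrict b I"
    using v ab by (auto simp: fun_eq_iff PiE_iff extensional_def)
  moreover have "restrict a I \<in> PiE I (\<lambda>_. A)" "restrict b I \<in> PiE I (\<lambda>_. B)"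
    using ab by auto
  ultimately show "v \<in> ?L" by (metis in_set_multI)
qed

lemma prodset_PiE:
  "prodset (product_group I (\<lambda>_. G)) (\<lambda>i. PiE I (\<lambda>_. B i)) n = PiE I (\<lambda>_. prodset G B n)"
proof (induction n)
  case 0
  show ?case by (auto simp: PiE_iff extensional_def fun_eq_iff)
next
  case (Suc n)
  then show ?case by (simp add: set_mult_PiE del: mult_product_group)
qed

text \<open>
  The removed set that corresponds to \<open>Y\<close> in the Cartesian power: a tuple is removed as soon as one of
  its coordinates is.  With this choice, being removed is tested coordinatewise in the product sets too, so
  the relative product set of a power is the power of the relative product set.
\<close>
lemma set_mult_power_bad_iff:
  assumes "u \<in> PiE I (\<lambda>_. (X \<union> Y) <#>\<^bsub>G\<^esub> D)"
  shows "u \<in> {t \<in> PiE I (\<lambda>_. X \<union> Y). \<exists>j\<in>I. t j \<in> Y} <#>\<^bsub>product_group I (\<lambda>_. G)\<^esub> (PiE I (\<lambda>_. D))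
    \<longleftrightarrow> (\<exists>j\<in>I. u j \<in> Y <#>\<^bsub>G\<^esub> D)" (is "u \<in> ?L \<longleftrightarrow> ?R")
proof
  assume "u \<in> ?L"
  then obtain t d j where "j \<in> I" "t j \<in> Y" "d \<in> PiE I (\<lambda>_. D)"
    "u = t \<otimes>\<^bsub>product_group I (\<lambda>_. G)\<^esub> d" by (auto elim!: in_set_multE)
  then show ?R by (intro bexI[of _ j]) (auto intro!: in_set_multI)
next
  assume ?R
  then obtain j y d where j: "j \<in> I" "y \<in> Y" "d \<in> D" "u j = y \<otimes>\<^bsub>G\<^esub> d" by (auto elim!: in_set_multE)
  have "\<forall>i\<in>I. \<exists>a b. a \<in> X \<union> Y \<and> b \<in> D \<and> u i = a \<otimes>\<^bsub>G\<^esub> b"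
    using assms by (fastforce simp: PiE_iff set_mult_def)
  then obtain a b where ab: "\<And>i. i \<in> I \<Longrightarrow> a i \<in> X \<union> Y \<and> b i \<in> D \<and> u i = a i \<otimes>\<^bsub>G\<^esub> b i"
    by metis
  let ?a = "restrict (a(j := y)) I" and ?b = "restrict (b(j := d)) I"
  have u: "u = ?a \<otimes>\<^bsub>product_group I (\<lambda>_. G)\<^esub> ?b"
    using assms ab j by (auto simp: fun_eq_iff PiE_iff extensional_def)
  have "?a \<in> {t \<in> PiE I (\<lambda>_. X \<union> Y). \<exists>j\<in>I. t j \<in> Y}" "?b \<in> PiE I (\<lambda>_. D)"
    using ab j by (auto simp: PiE_iff)
  then show "u \<in> ?L" unfolding u by (rule in_set_multI)
qed

lemma le_of_power_le_const_mult_power: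
  fixes a b c :: real
  assumes "a \<ge> 0" "b \<ge> 0" "\<And>k. a ^ k \<le> c * b ^ k"
  shows "a \<le> b"
proof (rule ccontr)
  assume "\<not> a \<le> b"
  then have "a > b" "a > 0" using assms by auto
  show False
  proof (cases "b = 0")
    case True
    then show ?thesis using assms(3)[of 1] \<open>a > 0\<close> by simp
  next
    case False
    then have b: "b > 0" using assms by simp
    then obtain k where "c < (a / b) ^ k"
      using \<open>a > b\<close> real_arch_pow[of "a / b" c] by auto
    then show False using assms(3)[of k] b by (simp add: power_divide field_simps not_less)
  qed
qed

text \<open>
  Let \<open>\<mu>\<close> be the least ratio \<open>|ZS - YS| / |Z|\<close> over \<open>Z \<subseteq> X\<close>, and \<open>P\<close> the product of the
  expansion ratios of \<open>X\<close>.  Applying the version with the constant in the \<open>k\<close>-th power of the group and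
  using multiplicativity gives \<open>\<mu> ^ k \<le> h ^ h * P ^ k\<close>; as the constant does not depend on \<open>k\<close>,
  it follows that \<open>\<mu> \<le> P\<close>.
\<close>
lemma (in comm_group) plunnecke_distinct_summands_pos:
  assumes fin: "finite X" "finite Y" "\<And>i. i \<in> {1..h} \<Longrightarrow> finite (B i)"
    and carr: "X \<subseteq> carrier G" "Y \<subseteq> carrier G" "\<And>i. i \<in> {1..h} \<Longrightarrow> B i \<subseteq> carrier G"
    and "X \<noteq> {}"
    and pos: "\<And>i. i \<in> {1..h} \<Longrightarrow> card ((X <#> B i) - (Y <#> B i)) > 0"
  obtains Z where "Z \<subseteq> X" "Z \<noteq> {}"
    "real (card ((Z <#> prodset G B h) - (Y <#> prodset G B h)))
      \<le> (\<Prod>i=1..h. card ((X <#> B i) - (Y <#> B i)) / real (card X)) * card Z"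
proof -
  define S where "S = prodset G B h"
  have S: "finite S" "S \<subseteq> carrier G" unfolding S_def
    by (rule finite_prodset, rule fin, assumption) (rule prodset_carrier, rule carr, assumption)
  define P where "P = (\<Prod>i=1..h. card ((X <#> B i) - (Y <#> B i)) / real (card X))"
  have P0: "P \<ge> 0" unfolding P_def by (intro prod_nonneg) auto
  define g where "g W = real (card ((W <#> S) - (Y <#> S)))" for W
  obtain Z where Z: "Z \<subseteq> X" "Z \<noteq> {}" "\<And>W. W \<subseteq> X \<Longrightarrow> g Z / card Z * card W \<le> g W"
    using exists_min_ratio_subset[of X g] fin \<open>X \<noteq> {}\<close> by (auto simp: g_def)
  define \<mu> where "\<mu> = g Z / card Z"
  have \<mu>0: "\<mu> \<ge> 0" by (simp add: \<mu>_def g_def)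
  define R where "R = {(x, t). x \<in> X \<and> (\<exists>s\<in>S. t = x \<otimes> s) \<and> t \<notin> Y <#> S}"
  have R: "R `` W = (W <#> S) - (Y <#> S)" if "W \<subseteq> X" for W
    using that by (auto simp: R_def intro: in_set_multI elim!: in_set_multE)
  have "\<mu> ^ k \<le> real h ^ h * P ^ k" for k
  proof -
    let ?I = "{..<k}"
    let ?H = "product_group ?I (\<lambda>_. G)"
    let ?pow = "\<lambda>A. PiE ?I (\<lambda>_. A)"
    let ?Y = "{t \<in> ?pow (X \<union> Y). \<exists>j\<in>?I. t j \<in> Y}"
    interpret H: comm_group ?H by (rule comm_group_product_group)
    have new: "(?pow X <#>\<^bsub>?H\<^esub> ?pow D) - (?Y <#>\<^bsub>?H\<^esub> ?pow D) = ?pow ((X <#> D) - (Y <#> D))" for D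
    proof -
      have "v \<in> ?Y <#>\<^bsub>?H\<^esub> ?pow D \<longleftrightarrow> (\<exists>j\<in>?I. v j \<in> Y <#> D)" if "v \<in> ?pow (X <#> D)" for v
        using that by (intro set_mult_power_bad_iff) (auto simp: set_mult_Un_left PiE_iff)
      then show ?thesis by (auto simp: set_mult_PiE PiE_iff simp del: mult_product_group)
    qed
    have card_new: "card ((?pow X <#>\<^bsub>?H\<^esub> ?pow (B i)) - (?Y <#>\<^bsub>?H\<^esub> ?pow (B i)))
        = card ((X <#> B i) - (Y <#> B i)) ^ k" for i
      unfolding new by (simp add: card_PiE)
    obtain V where V: "V \<subseteq> ?pow X" "V \<noteq> {}"
      "real (card ((V <#>\<^bsub>?H\<^esub> ?pow S) - (?Y <#>\<^bsub>?H\<^esub> ?pow S)))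
        \<le> real h ^ h * (\<Prod>i=1..h. card ((?pow X <#>\<^bsub>?H\<^esub> ?pow (B i)) - (?Y <#>\<^bsub>?H\<^esub> ?pow (B i)))
            / real (card (?pow X))) * card V"
    proof (rule H.plunnecke_with_constant[of "?pow X" ?Y h "\<lambda>i. ?pow (B i)", unfolded prodset_PiE, folded S_def])
      show "finite ?Y" by (rule finite_subset[of _ "?pow (X \<union> Y)"]) (use fin in \<open>auto intro!: finite_PiE\<close>)
      show "?pow X \<noteq> {}" using \<open>X \<noteq> {}\<close> by (simp add: PiE_eq_empty_iff)
      show "0 < card ((?pow X <#>\<^bsub>?H\<^esub> ?pow (B i)) - (?Y <#>\<^bsub>?H\<^esub> ?pow (B i)))" if "i \<in> {1..h}" for i
        unfolding card_new using pos[OF that] by simp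
      show "?Y \<subseteq> carrier ?H" using carr by (fastforce simp: PiE_iff)
      show "?pow X \<subseteq> carrier ?H" "\<And>i. i \<in> {1..h} \<Longrightarrow> ?pow (B i) \<subseteq> carrier ?H"
        using carr by (simp_all add: PiE_mono)
    qed (use fin in \<open>auto intro!: finite_PiE\<close>)
    have finV: "finite V" using V(1) fin by (meson finite_PiE finite_lessThan finite_subset)
    then have cV: "card V > 0" using V(2) by (simp add: card_gt_0_iff)
    have "(\<Prod>i=1..h. card ((?pow X <#>\<^bsub>?H\<^esub> ?pow (B i)) - (?Y <#>\<^bsub>?H\<^esub> ?pow (B i))) / real (card (?pow X)))
        = (\<Prod>i=1..h. (card ((X <#> B i) - (Y <#> B i)) / real (card X)) ^ k)"
      unfolding card_new by (simp add: card_PiE power_divide)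
    also have "\<dots> = P ^ k" by (simp add: P_def prod_power_distrib)
    finally have upper: "real (card ((V <#>\<^bsub>?H\<^esub> ?pow S) - (?Y <#>\<^bsub>?H\<^esub> ?pow S)))
        \<le> real h ^ h * P ^ k * card V" using V(3) by simp
    let ?N = "{v. \<exists>z\<in>V. (\<forall>i<k. (z i, v i) \<in> R) \<and> (\<forall>i\<ge>k. v i = z i)}"
    have "\<mu> ^ k * real (card V) \<le> real (card ?N)"
    proof (rule card_power_relation_ge)
      show "finite (R `` X)" using fin S by (simp add: R finite_set_mult)
      show "\<mu> * real (card W) \<le> real (card (R `` W))" if "W \<subseteq> X" for W
        using Z(3)[OF that] that by (simp add: R \<mu>_def g_def)
      show "z i \<in> X" if "z \<in> V" "i < k" for z i using V(1) that by (auto simp: PiE_iff)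
    qed (fact finV \<mu>0)+
    also have "card ?N \<le> card ((V <#>\<^bsub>?H\<^esub> ?pow S) - (?Y <#>\<^bsub>?H\<^esub> ?pow S))"
    proof (rule card_mono)
      show "finite ((V <#>\<^bsub>?H\<^esub> ?pow S) - (?Y <#>\<^bsub>?H\<^esub> ?pow S))"
        using finV S by (intro finite_Diff finite_set_mult finite_PiE) auto
      show "?N \<subseteq> (V <#>\<^bsub>?H\<^esub> ?pow S) - (?Y <#>\<^bsub>?H\<^esub> ?pow S)"
      proof
        fix v assume "v \<in> ?N"
        then obtain z where z: "z \<in> V" "\<forall>i<k. (z i, v i) \<in> R" "\<forall>i\<ge>k. v i = z i" by auto
        then have "\<forall>i<k. \<exists>s. s \<in> S \<and> v i = z i \<otimes> s" by (auto simp: R_def)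
        then obtain s where s: "\<And>i. i < k \<Longrightarrow> s i \<in> S \<and> v i = z i \<otimes> s i" by metis
        have zX: "z \<in> ?pow X" using z V by auto
        have "v = z \<otimes>\<^bsub>?H\<^esub> restrict s ?I" using s z(3) zX
          by (auto simp: fun_eq_iff PiE_iff extensional_def)
        moreover have "restrict s ?I \<in> ?pow S" using s by auto
        ultimately have "v \<in> V <#>\<^bsub>?H\<^esub> ?pow S" using z(1) by (metis in_set_multI)
        moreover have "v i \<in> R `` X" if "i < k" for i
          using z(2) zX that by (auto intro!: ImageI[of "z i" "v i"])
        then have "v \<in> ?pow ((X <#> S) - (Y <#> S))"
          using z zX R[of X] by (simp add: PiE_iff extensional_def)
        then have "v \<notin> ?Y <#>\<^bsub>?H\<^esub> ?pow S" unfolding new[symmetric] by blast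
        ultimately show "v \<in> (V <#>\<^bsub>?H\<^esub> ?pow S) - (?Y <#>\<^bsub>?H\<^esub> ?pow S)" by blast
      qed
    qed
    finally have "\<mu> ^ k * real (card V) \<le> real h ^ h * P ^ k * card V" using upper by simp
    then show ?thesis using cV by simp
  qed
  then have "\<mu> \<le> P" using le_of_power_le_const_mult_power \<mu>0 P0 by metis
  have "finite Z" using Z fin by (auto intro: finite_subset)
  then have "card Z > 0" using Z by (simp add: card_gt_0_iff)
  then have "g Z \<le> P * card Z" using \<open>\<mu> \<le> P\<close> by (simp add: \<mu>_def field_simps)
  then show ?thesis using Z by (intro that[of Z]) (auto simp: g_def S_def P_def)
qed

text \<open>
  This settles the degenerate case of Pluennecke's inequality: a factor \<open>B i\<close> that yields nothing new
  leaves nothing new after all factors, by commutativity.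
\<close>
lemma (in comm_group) set_mult_prodset_mono:
  assumes carr: "X \<subseteq> carrier G" "Y \<subseteq> carrier G" "\<And>i. i \<in> {1..n} \<Longrightarrow> B i \<subseteq> carrier G"
    and i: "i \<in> {1..n}" "X <#> B i \<subseteq> Y <#> B i"
  shows "X <#> prodset G B n \<subseteq> Y <#> prodset G B n"
  using carr(3) i(1)
proof (induction n)
  case (Suc n)
  have B: "B (Suc n) \<subseteq> carrier G" by (rule Suc.prems) auto
  have Bn: "B j \<subseteq> carrier G" if "j \<in> {1..n}" for j by (rule Suc.prems) (use that in auto)
  have P: "prodset G B n \<subseteq> carrier G" by (rule prodset_carrier) (rule Bn)
  show ?case
  proof (cases "i = Suc n")
    case True
    have comm: "U <#> (prodset G B n <#> B (Suc n)) = (U <#> B (Suc n)) <#> prodset G B n"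
      if "U \<subseteq> carrier G" for U
    proof -
      have "prodset G B n <#> B (Suc n) = B (Suc n) <#> prodset G B n"
        using P B by (intro equalityI subsetI; elim in_set_multE) (metis in_set_multI m_comm subsetD)+
      then show ?thesis using set_mult_assoc[OF that B P] by simp
    qed
    show ?thesis using i(2) True by (simp add: comm carr mono_set_mult)
  next
    case False
    then have "X <#> prodset G B n \<subseteq> Y <#> prodset G B n"
      using Suc.IH Bn Suc.prems(2) by auto
    then have "(X <#> prodset G B n) <#> B (Suc n) \<subseteq> (Y <#> prodset G B n) <#> B (Suc n)"
      by (simp add: mono_set_mult)
    then show ?thesis using set_mult_assoc[OF carr(1) P B] set_mult_assoc[OF carr(2) P B] by simp
  qed
qed auto

lemma (in comm_group) plunnecke_distinct_summands:
  assumes fin: "finite X" "finite Y" "\<And>i. i \<in> {1..h} \<Longrightarrow> finite (B i)"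
    and carr: "X \<subseteq> carrier G" "Y \<subseteq> carrier G" "\<And>i. i \<in> {1..h} \<Longrightarrow> B i \<subseteq> carrier G"
    and "X \<noteq> {}"
  obtains Z where "Z \<subseteq> X" "Z \<noteq> {}"
    "real (card ((Z <#> prodset G B h) - (Y <#> prodset G B h)))
      \<le> (\<Prod>i=1..h. card ((X <#> B i) - (Y <#> B i)) / real (card X)) * card Z"
proof (cases "\<forall>i\<in>{1..h}. card ((X <#> B i) - (Y <#> B i)) > 0")
  case True
  then show ?thesis using plunnecke_distinct_summands_pos[of X Y h B] assms that by blast
next
  case False
  then obtain i where i: "i \<in> {1..h}" "card ((X <#> B i) - (Y <#> B i)) = 0" by auto
  then have "X <#> B i \<subseteq> Y <#> B i" using fin by (simp add: finite_set_mult)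
  then have "(X <#> prodset G B h) - (Y <#> prodset G B h) = {}"
    using set_mult_prodset_mono[of X Y h B i] carr i(1) by blast
  moreover have "0 \<le> (\<Prod>i=1..h. card ((X <#> B i) - (Y <#> B i)) / real (card X))"
    by (intro prod_nonneg) auto
  ultimately show ?thesis
    using \<open>X \<noteq> {}\<close> by (intro that[of X]) (simp_all only: card.empty of_nat_0 mult_nonneg_nonneg of_nat_0_le_iff subset_refl not_False_eq_True)
qed

section \<open>Decomposition by expansion ratio\<close>

text \<open>
  The inequality of arithmetic and geometric means, from \<open>1 + t \<le> exp t\<close> at \<open>t = x i / a - 1\<close>
  with \<open>a\<close> the mean: the exponents sum to zero.
\<close>
lemma prod_le_mean_power:
  fixes x :: "'i \<Rightarrow> real"
  assumes "finite I" "I \<noteq> {}" and nonneg: "\<And>i. i \<in> I \<Longrightarrow> 0 \<le> x i"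
  shows "(\<Prod>i\<in>I. x i) \<le> ((\<Sum>i\<in>I. x i) / card I) ^ card I"
proof -
  define a where "a = (\<Sum>i\<in>I. x i) / card I"
  have n: "card I > 0" using assms by (simp add: card_gt_0_iff)
  have "a \<ge> 0" unfolding a_def by (intro divide_nonneg_nonneg sum_nonneg nonneg) auto
  then consider "a = 0" | "a > 0" by linarith
  then show ?thesis
  proof cases
    case 1
    then have "(\<Sum>i\<in>I. x i) = 0" using n by (simp add: a_def)
    then have "\<forall>i\<in>I. x i = 0" using sum_nonneg_eq_0_iff[OF assms(1) nonneg] by simp
    then show ?thesis using n assms 1 by (simp add: a_def[symmetric])
  next
    case 2
    have "(\<Prod>i\<in>I. x i / a) \<le> (\<Prod>i\<in>I. exp (x i / a - 1))"
    proof (rule prod_mono)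
      fix i assume "i \<in> I"
      then show "0 \<le> x i / a \<and> x i / a \<le> exp (x i / a - 1)"
        using nonneg 2 exp_ge_add_one_self[of "x i / a - 1"] by auto
    qed
    also have "\<dots> = exp ((\<Sum>i\<in>I. x i) / a - card I)"
      using assms(1) by (simp add: sum_subtractf sum_divide_distrib flip: exp_sum)
    also have "(\<Sum>i\<in>I. x i) / a = card I" using 2 n by (simp add: a_def field_simps)
    finally have "(\<Prod>i\<in>I. x i) / a ^ card I \<le> 1" by (simp add: prod_dividef)
    then show ?thesis using 2 by (simp add: a_def[symmetric] field_simps)
  qed
qed

lemma card_new_products_Un:
  assumes "finite X" "finite Z" "finite D"
  shows "card (((Z \<union> X) <#>\<^bsub>G\<^esub> D) - (Y <#>\<^bsub>G\<^esub> D))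
    = card ((Z <#>\<^bsub>G\<^esub> D) - (Y <#>\<^bsub>G\<^esub> D)) + card ((X <#>\<^bsub>G\<^esub> D) - ((Y \<union> Z) <#>\<^bsub>G\<^esub> D))"
proof -
  have "((Z \<union> X) <#>\<^bsub>G\<^esub> D) - (Y <#>\<^bsub>G\<^esub> D)
      = ((Z <#>\<^bsub>G\<^esub> D) - (Y <#>\<^bsub>G\<^esub> D)) \<union> ((X <#>\<^bsub>G\<^esub> D) - ((Y \<union> Z) <#>\<^bsub>G\<^esub> D))"
    unfolding set_mult_Un_left by blast
  moreover have "((Z <#>\<^bsub>G\<^esub> D) - (Y <#>\<^bsub>G\<^esub> D)) \<inter> ((X <#>\<^bsub>G\<^esub> D) - ((Y \<union> Z) <#>\<^bsub>G\<^esub> D)) = {}"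
    unfolding set_mult_Un_left by blast
  ultimately show ?thesis using assms by (simp add: card_Un_disjoint finite_set_mult)
qed

text \<open>
  The normalised number of elements that \<open>X\<close> contributes beyond \<open>Y\<close>, averaged over the factors.
  Dividing by \<open>\<alpha> i\<close> gives every factor the same budget: the hypothesis \<open>|A B i| \<le> \<alpha> i * |A|\<close>
  says that the whole of \<open>A\<close> has mean at most \<open>|A|\<close>.
\<close>
definition mean_new :: "('a, 'b) monoid_scheme \<Rightarrow> nat \<Rightarrow> (nat \<Rightarrow> real) \<Rightarrow> (nat \<Rightarrow> 'a set)
    \<Rightarrow> 'a set \<Rightarrow> 'a set \<Rightarrow> real" where
  "mean_new G h \<alpha> B Y X =
     (\<Sum>i=1..h. real (card ((X <#>\<^bsub>G\<^esub> B i) - (Y <#>\<^bsub>G\<^esub> B i))) / \<alpha> i) / real h"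

lemma mean_new_Un:
  assumes "finite X" "finite Z" "\<And>i. i \<in> {1..h} \<Longrightarrow> finite (B i)"
  shows "mean_new G h \<alpha> B Y (Z \<union> X) = mean_new G h \<alpha> B Y Z + mean_new G h \<alpha> B (Y \<union> Z) X"
  using assms
  by (simp add: mean_new_def card_new_products_Un add_divide_distrib sum.distrib)

lemma mean_new_empty [simp]: "mean_new G h \<alpha> B Y {} = 0"
  by (simp add: mean_new_def)

text \<open>
  A set of minimal ratio \<open>\<rho>\<close> obeys Pluennecke's inequality as a whole, not only on some subset.
  Take a maximal \<open>U \<subseteq> X\<close> for which the bound holds.  By minimality \<open>U\<close> has used up at least
  \<open>\<rho> |U|\<close> of the total, which is at most \<open>\<rho> |X|\<close>, so the rest of \<open>X\<close> has ratio at most \<open>\<rho>\<close> relative to \<open>Y \<union> U\<close>.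
  Pluennecke's inequality for the rest, with the ratios of the separate factors combined by the
  inequality of means, gives a further nonempty piece that could be added to \<open>U\<close>.
\<close>
lemma (in comm_group) tight_set_growth:
  fixes \<alpha> :: "nat \<Rightarrow> real" and \<rho> :: real
  assumes fin: "finite X" "finite Y" "\<And>i. i \<in> {1..h} \<Longrightarrow> finite (B i)"
    and carr: "X \<subseteq> carrier G" "Y \<subseteq> carrier G" "\<And>i. i \<in> {1..h} \<Longrightarrow> B i \<subseteq> carrier G"
    and h: "h \<ge> 1" and \<alpha>: "\<And>i. i \<in> {1..h} \<Longrightarrow> \<alpha> i > 0"
    and tight: "mean_new G h \<alpha> B Y X \<le> \<rho> * card X"
    and min: "\<And>Z. Z \<subseteq> X \<Longrightarrow> \<rho> * card Z \<le> mean_new G h \<alpha> B Y Z"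
  shows "real (card ((X <#> prodset G B h) - (Y <#> prodset G B h)))
    \<le> (\<Prod>i=1..h. \<alpha> i) * \<rho> ^ h * card X"
proof -
  define S where "S = prodset G B h"
  define P where "P = (\<Prod>i=1..h. \<alpha> i)"
  have finS: "finite S" unfolding S_def by (rule finite_prodset) (rule fin)
  define good where "good U \<longleftrightarrow> U \<subseteq> X \<and> real (card ((U <#> S) - (Y <#> S))) \<le> P * \<rho> ^ h * card U" for U
  have P0: "P > 0" unfolding P_def using \<alpha> by (intro prod_pos) auto
  have "finite (Collect good)"
    by (rule finite_subset[of _ "Pow X"]) (use fin in \<open>auto simp: good_def\<close>)
  moreover have "good {}" by (simp add: good_def)
  ultimately obtain U where U: "good U" "\<And>V. good V \<Longrightarrow> U \<subseteq> V \<Longrightarrow> V = U"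
    using finite_has_maximal[of "Collect good"] by blast
  have UX: "U \<subseteq> X" using U by (simp add: good_def)
  have finU: "finite U" using UX fin by (auto intro: finite_subset)
  have "U = X"
  proof (rule ccontr)
    assume "U \<noteq> X"
    define X' where "X' = X - U"
    have X': "X' \<noteq> {}" "finite X'" "X' \<subseteq> carrier G" "U \<union> X' = X"
      using UX \<open>U \<noteq> X\<close> fin carr by (auto simp: X'_def)
    have cX': "real (card X') = real (card X) - real (card U)" "card X' > 0"
      using UX X' fin finU by (simp_all add: X'_def card_Diff_subset card_mono of_nat_diff psubset_card_mono psubset_eq)
    have "mean_new G h \<alpha> B (Y \<union> U) X' = mean_new G h \<alpha> B Y X - mean_new G h \<alpha> B Y U"
      using mean_new_Un[of X' U h B G \<alpha> Y] X' finU fin by simp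
    also have "\<dots> \<le> \<rho> * card X'" using tight min[OF UX] unfolding cX'(1) right_diff_distrib by linarith
    finally have mean: "mean_new G h \<alpha> B (Y \<union> U) X' / card X' \<le> \<rho>" using cX'(2) by (simp add: pos_divide_le_eq)
    obtain Z where Z: "Z \<subseteq> X'" "Z \<noteq> {}"
      "real (card ((Z <#> S) - ((Y \<union> U) <#> S)))
        \<le> (\<Prod>i=1..h. card ((X' <#> B i) - ((Y \<union> U) <#> B i)) / real (card X')) * card Z"
      unfolding S_def
    proof (rule plunnecke_distinct_summands[of X' "Y \<union> U" h B])
      show "Y \<union> U \<subseteq> carrier G" using UX carr by auto
    qed (use X' fin carr finU in auto)
    define q where "q i = card ((X' <#> B i) - ((Y \<union> U) <#> B i)) / real (card X') / \<alpha> i" for i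
    have q0: "q i \<ge> 0" if "i \<in> {1..h}" for i using \<alpha>[OF that] by (simp add: q_def)
    have "(\<Prod>i=1..h. card ((X' <#> B i) - ((Y \<union> U) <#> B i)) / real (card X')) = (\<Prod>i=1..h. \<alpha> i * q i)"
    proof (rule prod.cong)
      fix i assume "i \<in> {1..h}"
      then show "card ((X' <#> B i) - ((Y \<union> U) <#> B i)) / real (card X') = \<alpha> i * q i"
        using \<alpha>[of i] by (simp add: q_def)
    qed simp
    also have "\<dots> = P * (\<Prod>i=1..h. q i)" by (simp add: prod.distrib P_def)
    also have "\<dots> \<le> P * ((\<Sum>i=1..h. q i) / h) ^ h"
      using prod_le_mean_power[of "{1..h}" q] q0 h P0 by simp
    also have "(\<Sum>i=1..h. q i) / h = mean_new G h \<alpha> B (Y \<union> U) X' / card X'"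
      by (simp add: q_def mean_new_def sum_divide_distrib mult_ac)
    also have "P * (mean_new G h \<alpha> B (Y \<union> U) X' / card X') ^ h \<le> P * \<rho> ^ h"
    proof (intro mult_left_mono power_mono mean)
      show "0 \<le> mean_new G h \<alpha> B (Y \<union> U) X' / card X'" unfolding mean_new_def
        using \<alpha> by (intro divide_nonneg_nonneg sum_nonneg) (auto simp: less_imp_le)
    qed (use P0 in simp)
    finally have "real (card ((Z <#> S) - ((Y \<union> U) <#> S))) \<le> P * \<rho> ^ h * card Z"
      using Z(3) by (meson mult_right_mono of_nat_0_le_iff order_trans)
    moreover have finZ: "finite Z" using Z X' by (auto intro: finite_subset)
    moreover have "U \<inter> Z = {}" using Z by (auto simp: X'_def)
    ultimately have "good (U \<union> Z)"
      using U(1) Z X' finU finS unfolding good_def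
      by (auto simp: card_new_products_Un card_Un_disjoint algebra_simps)
    then have "U \<union> Z = U" using U(2) by blast
    then show False using Z by (auto simp: X'_def)
  qed
  then show ?thesis using U by (simp add: good_def S_def P_def)
qed

text \<open>
  Convexity: on \<open>[\<beta>, \<beta> M]\<close> the function \<open>\<rho> ^ h\<close> lies below its chord, whose slope is
  \<open>\<beta> ^ (h - 1) * (M ^ h - 1) / (M - 1)\<close>; the geometric sum also covers \<open>M = 1\<close>.
\<close>
lemma power_le_chord:
  fixes \<beta> \<rho> M :: real
  assumes "0 \<le> \<beta>" "\<beta> \<le> \<rho>" "\<rho> \<le> \<beta> * M" and h: "h \<ge> 1"
  shows "\<rho> ^ h \<le> \<beta> ^ h + (\<rho> - \<beta>) * \<beta> ^ (h - 1) * (\<Sum>j<h. M ^ j)"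
proof -
  obtain n where n: "h = Suc n" using h by (cases h) auto
  have "\<rho> ^ h - \<beta> ^ h = (\<rho> - \<beta>) * (\<Sum>p<Suc n. \<rho> ^ p * \<beta> ^ (n - p))"
    unfolding n by (rule diff_power_eq_sum)
  also have "\<dots> \<le> (\<rho> - \<beta>) * (\<Sum>p<Suc n. \<beta> ^ n * M ^ p)"
  proof (intro mult_left_mono sum_mono)
    fix p assume "p \<in> {..<Suc n}"
    then have "\<beta> ^ n = \<beta> ^ p * \<beta> ^ (n - p)" by (simp add: power_add[symmetric])
    moreover have "\<rho> ^ p \<le> (\<beta> * M) ^ p" using assms by (intro power_mono) auto
    ultimately show "\<rho> ^ p * \<beta> ^ (n - p) \<le> \<beta> ^ n * M ^ p"
      using assms mult_right_mono[of "\<rho> ^ p" "(\<beta> * M) ^ p" "\<beta> ^ (n - p)"]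
      by (simp add: power_mult_distrib mult_ac)
  qed (use assms in simp)
  also have "\<dots> = (\<rho> - \<beta>) * \<beta> ^ (h - 1) * (\<Sum>j<h. M ^ j)"
    by (simp add: n sum_distrib_left[symmetric] mult.assoc)
  finally show ?thesis by simp
qed

lemma card_set_mult_le: "finite A \<Longrightarrow> finite B \<Longrightarrow> card (A <#>\<^bsub>G\<^esub> B) \<le> card A * card B"
proof -
  assume "finite A" "finite B"
  moreover have "A <#>\<^bsub>G\<^esub> B = (\<lambda>(a, b). a \<otimes>\<^bsub>G\<^esub> b) ` (A \<times> B)"
    by (auto simp: set_mult_def)
  ultimately show ?thesis by (metis card_cartesian_product card_image_le finite_cartesian_product)
qed

text \<open>
  The set \<open>X\<close> is peeled off in pieces of minimal ratio, so that a piece \<open>Z\<close> of ratio \<open>\<rho>\<close>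
  contributes at most \<open>P \<rho>^h |Z|\<close>.  Once the ratio exceeds \<open>\<beta> M\<close>, the trivial bound \<open>|X| |S|\<close> takes
  over.  Both are bounded by the chord, which is linear in \<open>\<rho>\<close>, and therefore the sum depends only
  on \<open>|X|\<close> and on the total mean, which is additive along the decomposition.  The chord meets the
  trivial bound \<open>P \<beta>^h M^h\<close> per element exactly at \<open>\<rho> = \<beta> M\<close>.
\<close>
lemma (in comm_group) new_products_bound:
  fixes \<alpha> :: "nat \<Rightarrow> real" and \<beta> M :: real
  assumes "finite X" "finite Y" and finB: "\<And>i. i \<in> {1..h} \<Longrightarrow> finite (B i)"
    and "X \<subseteq> carrier G" "Y \<subseteq> carrier G" and carrB: "\<And>i. i \<in> {1..h} \<Longrightarrow> B i \<subseteq> carrier G"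
    and h: "h \<ge> 1" and \<alpha>: "\<And>i. i \<in> {1..h} \<Longrightarrow> \<alpha> i > 0"
    and \<beta>: "\<beta> \<ge> 0" and M: "M \<ge> 1"
    and S: "real (card (prodset G B h)) \<le> (\<Prod>i=1..h. \<alpha> i) * \<beta> ^ h * M ^ h"
    and "\<And>W. W \<subseteq> X \<Longrightarrow> \<beta> * card W \<le> mean_new G h \<alpha> B Y W"
  shows "real (card ((X <#> prodset G B h) - (Y <#> prodset G B h)))
    \<le> (\<Prod>i=1..h. \<alpha> i) * (card X * \<beta> ^ h
        + (mean_new G h \<alpha> B Y X - \<beta> * card X) * \<beta> ^ (h - 1) * (\<Sum>j<h. M ^ j))"
proof -
  define S where "S = prodset G B h"
  define P where "P = (\<Prod>i=1..h. \<alpha> i)"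
  define D where "D = (\<Sum>j<h. M ^ j)"
  have finS: "finite S" unfolding S_def by (rule finite_prodset) (rule finB)
  have P0: "P > 0" unfolding P_def using \<alpha> by (intro prod_pos) auto
  have D0: "D \<ge> 0" unfolding D_def using M by (intro sum_nonneg) auto
  have MD: "(M - 1) * D = M ^ h - 1" by (simp add: D_def power_diff_1_eq)
  have \<beta>h: "\<beta> ^ h = \<beta> * \<beta> ^ (h - 1)" using h by (simp add: power_eq_if)
  show ?thesis
    using assms(1,2,4,5) assms(12)
    unfolding S_def[symmetric] P_def[symmetric] D_def[symmetric]
  proof (induction "card X" arbitrary: X Y rule: less_induct)
    case (less X Y)
    show ?case
    proof (cases "X = {}")
      case False
      obtain Z where Z: "Z \<subseteq> X" "Z \<noteq> {}"
        "\<And>W. W \<subseteq> X \<Longrightarrow> mean_new G h \<alpha> B Y Z / card Z * card W \<le> mean_new G h \<alpha> B Y W"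
        using exists_min_ratio_subset[of X "mean_new G h \<alpha> B Y"] less.prems(1) False by auto
      define \<rho> where "\<rho> = mean_new G h \<alpha> B Y Z / card Z"
      have finZ: "finite Z" using Z less.prems by (auto intro: finite_subset)
      have cZ: "card Z > 0" using Z finZ by (simp add: card_gt_0_iff)
      have meanZ: "mean_new G h \<alpha> B Y Z = \<rho> * card Z" using cZ by (simp add: \<rho>_def)
      have \<rho>min: "\<rho> * card W \<le> mean_new G h \<alpha> B Y W" if "W \<subseteq> X" for W
        using Z(3)[OF that] by (simp add: \<rho>_def)
      have "\<beta> * card Z \<le> \<rho> * card Z" using less.prems(5)[OF Z(1)] meanZ by simp
      then have \<beta>\<rho>: "\<beta> \<le> \<rho>" using cZ by simp
      show ?thesis
      proof (cases "\<rho> \<le> \<beta> * M")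
        case False
        \<comment> \<open>All ratios exceed \<open>\<beta> M\<close>: the trivial bound is at most the chord.\<close>
        have "card ((X <#> S) - (Y <#> S)) \<le> card X * card S"
          using card_set_mult_le[OF less.prems(1) finS, of G]
            card_mono[of "X <#> S" "(X <#> S) - (Y <#> S)"] less.prems(1) finS
          by (auto simp: finite_set_mult)
        then have "real (card ((X <#> S) - (Y <#> S))) \<le> real (card X) * real (card S)"
          by (metis of_nat_le_iff of_nat_mult)
        also have "\<dots> \<le> card X * (P * \<beta> ^ h * M ^ h)"
          using S by (intro mult_left_mono) (auto simp: S_def P_def)
        also have "\<dots> = P * (card X * \<beta> ^ h + (\<beta> * M * card X - \<beta> * card X) * \<beta> ^ (h - 1) * D)"
        proof -
          have "M ^ h = 1 + (M - 1) * D" using MD by simp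
          then show ?thesis by (simp only: \<beta>h) (simp add: algebra_simps)
        qed
        also have "\<dots> \<le> P * (card X * \<beta> ^ h + (mean_new G h \<alpha> B Y X - \<beta> * card X) * \<beta> ^ (h - 1) * D)"
        proof -
          have "\<beta> * M * card X \<le> \<rho> * card X" using False by (intro mult_right_mono) auto
          also have "\<dots> \<le> mean_new G h \<alpha> B Y X" using \<rho>min by blast
          finally show ?thesis
            using P0 D0 \<beta> by (intro mult_left_mono add_left_mono mult_right_mono) auto
        qed
        finally show ?thesis .
      next
        case True
        define X' where "X' = X - Z"
        have X': "finite X'" "X' \<subseteq> carrier G" "Z \<union> X' = X" "card X = card Z + card X'"
          using less.prems Z finZ by (auto simp: X'_def card_Diff_subset card_mono)
        have Zc: "Z \<subseteq> carrier G" using Z less.prems by auto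
        have ind: "real (card ((X' <#> S) - ((Y \<union> Z) <#> S)))
          \<le> P * (card X' * \<beta> ^ h + (mean_new G h \<alpha> B (Y \<union> Z) X' - \<beta> * card X') * \<beta> ^ (h - 1) * D)"
        proof (rule less.hyps)
          show "card X' < card X" using X' cZ by simp
          \<comment> \<open>Minimal ratios do not decrease along the decomposition, because \<open>Z\<close> was itself minimal.\<close>
          show "\<beta> * card W \<le> mean_new G h \<alpha> B (Y \<union> Z) W" if W: "W \<subseteq> X'" for W
          proof -
            have finW: "finite W" using W X' by (auto intro: finite_subset)
            have "\<rho> * card (Z \<union> W) \<le> mean_new G h \<alpha> B Y (Z \<union> W)"
              using \<rho>min[of "Z \<union> W"] W X' by auto
            moreover have "card (Z \<union> W) = card Z + card W"
              using finW finZ W by (intro card_Un_disjoint) (auto simp: X'_def)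
            ultimately have "\<rho> * card W \<le> mean_new G h \<alpha> B (Y \<union> Z) W"
              using mean_new_Un[where G = G and \<alpha> = \<alpha> and Y = Y, OF finW finZ finB] meanZ by (simp add: algebra_simps)
            moreover have "\<beta> * card W \<le> \<rho> * card W" using \<beta>\<rho> by (intro mult_right_mono) auto
            ultimately show ?thesis by linarith
          qed
        qed (use X' less.prems finZ Zc in auto)
        have "real (card ((Z <#> S) - (Y <#> S))) \<le> P * \<rho> ^ h * card Z"
          unfolding S_def P_def
        proof (rule tight_set_growth)
          show "\<rho> * card W \<le> mean_new G h \<alpha> B Y W" if "W \<subseteq> Z" for W
            using \<rho>min[of W] that Z(1) by auto
        qed (use finZ Zc less.prems finB carrB h \<alpha> meanZ in auto)
        also have "\<dots> \<le> P * (\<beta> ^ h + (\<rho> - \<beta>) * \<beta> ^ (h - 1) * D) * card Z"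
          using power_le_chord[OF \<beta> \<beta>\<rho> True h] P0 unfolding D_def
          by (intro mult_right_mono mult_left_mono) auto
        finally have "real (card ((Z <#> S) - (Y <#> S)))
            \<le> P * (card Z * \<beta> ^ h + (mean_new G h \<alpha> B Y Z - \<beta> * card Z) * \<beta> ^ (h - 1) * D)"
          by (simp add: meanZ algebra_simps)
        with ind have "real (card ((Z <#> S) - (Y <#> S))) + real (card ((X' <#> S) - ((Y \<union> Z) <#> S)))
            \<le> P * ((card Z + card X') * \<beta> ^ h
              + ((mean_new G h \<alpha> B Y Z + mean_new G h \<alpha> B (Y \<union> Z) X') - \<beta> * (card Z + card X')) * \<beta> ^ (h - 1) * D)"
          by (simp add: algebra_simps)
        moreover have "card ((X <#> S) - (Y <#> S))
            = card ((Z <#> S) - (Y <#> S)) + card ((X' <#> S) - ((Y \<union> Z) <#> S))"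
          using card_new_products_Un[OF X'(1) finZ finS, of G Y] X' by simp
        moreover have "mean_new G h \<alpha> B Y X = mean_new G h \<alpha> B Y Z + mean_new G h \<alpha> B (Y \<union> Z) X'"
          using mean_new_Un[where G = G and \<alpha> = \<alpha> and Y = Y, OF X'(1) finZ finB] X' by simp
        ultimately show ?thesis using X'(4) by simp
      qed
    qed simp
  qed
qed

text \<open>
  Equality holds at \<open>\<beta> = 1 - 1/h\<close>.  For \<open>h \<ge> 2\<close>, in terms of \<open>u = \<beta> / (1 - 1/h)\<close> and \<open>n = h - 1\<close>
  it is the inequality \<open>n u^(n+1) - (n+1) u^n + 1 \<ge> 0\<close>, proved by induction on \<open>n\<close>.
\<close>
lemma interior_maximum:
  fixes \<beta> :: real
  assumes "0 \<le> \<beta>" "\<beta> \<le> 1" "h \<ge> 1"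
  shows "(1 - \<beta>) * \<beta> ^ (h - 1) \<le> (1 - 1 / real h) ^ (h - 1) / real h"
proof -
  obtain n where n: "h = Suc n" using assms by (cases h) auto
  have aux: "0 \<le> real n * u ^ (n + 1) - (real n + 1) * u ^ n + 1" if "u \<ge> 0" for u :: real and n
  proof (induction n)
    case (Suc n)
    have "0 \<le> (u - 1) * (u ^ (n + 1) - 1)"
    proof (cases "u \<ge> 1")
      case True
      then have "u ^ (n + 1) \<ge> 1" by (rule one_le_power)
      then show ?thesis using True by (intro mult_nonneg_nonneg) auto
    next
      case False
      then have "u ^ (n + 1) \<le> 1" using that by (intro power_le_one) auto
      then show ?thesis using False by (intro mult_nonpos_nonpos) auto
    qed
    moreover have "real (Suc n) * u ^ (Suc n + 1) - (real (Suc n) + 1) * u ^ Suc n + 1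
        = u * (real n * u ^ (n + 1) - (real n + 1) * u ^ n + 1) + (u - 1) * (u ^ (n + 1) - 1)"
      by (simp add: algebra_simps)
    ultimately show ?case using mult_nonneg_nonneg[OF that Suc] by linarith
  qed simp
  show ?thesis
  proof (cases "n = 0")
    case False
    define t where "t = 1 - 1 / real h"
    have t: "t > 0" "t * h = n" using False by (auto simp: t_def n field_simps)
    define u where "u = \<beta> / t"
    have "u \<ge> 0" "\<beta> = t * u" using assms t by (auto simp: u_def)
    have "(h - real n * u) * u ^ n \<le> 1" using aux[OF \<open>u \<ge> 0\<close>, of n] by (simp add: n algebra_simps)
    moreover have "(1 - \<beta>) * \<beta> ^ n * h = t ^ n * ((h - real n * u) * u ^ n)"
      unfolding \<open>\<beta> = t * u\<close> t(2)[symmetric] by (simp add: power_mult_distrib algebra_simps)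
    ultimately have "(1 - \<beta>) * \<beta> ^ n * h \<le> t ^ n"
      using t mult_left_mono[of "(h - real n * u) * u ^ n" 1 "t ^ n"] by simp
    then have "(1 - \<beta>) * \<beta> ^ n \<le> t ^ n / h" using n by (simp add: pos_le_divide_eq)
    moreover have "h - 1 = n" using n by simp
    ultimately show ?thesis unfolding t_def by metis
  qed (use assms n in simp)
qed

text \<open>
  Let \<open>\<beta>\<close> be the minimal ratio of subsets of \<open>A\<close>, attained at \<open>Z\<close>.  Then
  \<open>|S| \<le> |ZS| \<le> P \<beta>^h |A|\<close>, which fixes the trivial bound in the decomposition with \<open>M^h = |A|\<close>.
  The resulting estimate contains \<open>(1 - \<beta>) \<beta>^(h-1)\<close>, and its maximum is the constant of the theorem.
\<close>
lemma (in comm_group) product_set_bound: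
  fixes \<alpha> :: "nat \<Rightarrow> real" and M :: real
  assumes A: "finite A" "A \<noteq> {}" "A \<subseteq> carrier G"
    and B: "\<And>i. i \<in> {1..h} \<Longrightarrow> finite (B i)" "\<And>i. i \<in> {1..h} \<Longrightarrow> B i \<subseteq> carrier G"
    and h: "h \<ge> 1" and \<alpha>: "\<And>i. i \<in> {1..h} \<Longrightarrow> \<alpha> i > 0"
    and small: "\<And>i. i \<in> {1..h} \<Longrightarrow> real (card (A <#> B i)) \<le> \<alpha> i * card A"
    and M: "M \<ge> 1" "M ^ h = card A"
  shows "real (card (A <#> prodset G B h))
    \<le> (\<Prod>i=1..h. \<alpha> i) * card A * (1 + (1 - 1 / real h) ^ (h - 1) / real h * (\<Sum>j<h. M ^ j))"
proof -
  define S where "S = prodset G B h"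
  define P where "P = (\<Prod>i=1..h. \<alpha> i)"
  define D where "D = (\<Sum>j<h. M ^ j)"
  define f where "f = mean_new G h \<alpha> B {}"
  have P0: "P > 0" unfolding P_def using \<alpha> by (intro prod_pos) auto
  have D0: "D \<ge> 0" unfolding D_def using M by (intro sum_nonneg) auto
  have finS: "finite S" unfolding S_def by (rule finite_prodset) (rule B)
  have carrS: "S \<subseteq> carrier G" unfolding S_def by (rule prodset_carrier) (rule B)
  obtain Z where Z: "Z \<subseteq> A" "Z \<noteq> {}" "\<And>W. W \<subseteq> A \<Longrightarrow> f Z / card Z * card W \<le> f W"
    using exists_min_ratio_subset[of A f] A by (auto simp: f_def)
  define \<beta> where "\<beta> = f Z / card Z"
  have finZ: "finite Z" using Z A by (auto intro: finite_subset)
  have f0: "f W \<ge> 0" for W unfolding f_def mean_new_def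
    using \<alpha> by (intro divide_nonneg_nonneg sum_nonneg) (auto simp: less_imp_le)
  have \<beta>0: "\<beta> \<ge> 0" unfolding \<beta>_def using f0 by simp
  have cA: "card A > 0" using A by (simp add: card_gt_0_iff)
  have fA: "f A \<le> card A"
  proof -
    have "(\<Sum>i=1..h. real (card (A <#> B i)) / \<alpha> i) \<le> (\<Sum>i=1..h. real (card A))"
      using small \<alpha> by (intro sum_mono) (simp add: pos_divide_le_eq mult.commute)
    then show ?thesis using h by (simp add: f_def mean_new_def field_simps)
  qed
  have "\<beta> * card A \<le> 1 * card A" using Z(3)[of A] fA by (simp add: \<beta>_def)
  then have \<beta>1: "\<beta> \<le> 1" using cA by simp
  have "real (card S) \<le> card (Z <#> S)"
  proof -
    obtain z where z: "z \<in> Z" using Z by auto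
    have "inj_on ((\<otimes>) z) S" using z Z A carrS by (intro inj_onI) (auto simp: subset_iff)
    then have "card S = card ((\<otimes>) z ` S)" by (simp add: card_image)
    also have "\<dots> \<le> card (Z <#> S)"
      using z finZ finS by (intro card_mono finite_set_mult) (auto intro: in_set_multI)
    finally show ?thesis by simp
  qed
  also have "real (card (Z <#> S)) \<le> P * \<beta> ^ h * card Z"
  proof -
    have "real (card ((Z <#> S) - ({} <#> S))) \<le> P * \<beta> ^ h * card Z"
      unfolding S_def P_def
    proof (rule tight_set_growth)
      show "\<beta> * card W \<le> mean_new G h \<alpha> B {} W" if "W \<subseteq> Z" for W
        using Z(3)[of W] that Z(1) by (auto simp: \<beta>_def f_def)
      show "mean_new G h \<alpha> B {} Z \<le> \<beta> * card Z"
        using finZ Z(2) by (simp add: \<beta>_def f_def)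
    qed (use finZ Z A B h \<alpha> in auto)
    then show ?thesis by simp
  qed
  also have "\<dots> \<le> P * \<beta> ^ h * M ^ h"
    unfolding M(2) using Z A P0 \<beta>0 by (intro mult_left_mono) (auto intro: card_mono)
  finally have S: "real (card S) \<le> P * \<beta> ^ h * M ^ h" .
  have "real (card ((A <#> S) - ({} <#> S)))
      \<le> P * (card A * \<beta> ^ h + (mean_new G h \<alpha> B {} A - \<beta> * card A) * \<beta> ^ (h - 1) * D)"
    unfolding S_def P_def D_def
  proof (rule new_products_bound)
    show "\<beta> * card W \<le> mean_new G h \<alpha> B {} W" if "W \<subseteq> A" for W
      using Z(3)[OF that] by (simp add: \<beta>_def f_def)
  qed (use A B h \<alpha> \<beta>0 M S in \<open>auto simp: S_def P_def\<close>)
  then have "real (card (A <#> S)) \<le> P * (card A * \<beta> ^ h + (f A - \<beta> * card A) * \<beta> ^ (h - 1) * D)"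
    by (simp add: f_def)
  also have "\<dots> \<le> P * (card A * 1 + (card A - \<beta> * card A) * \<beta> ^ (h - 1) * D)"
  proof -
    have "card A * \<beta> ^ h \<le> real (card A) * 1"
      using \<beta>0 \<beta>1 by (intro mult_left_mono power_le_one) auto
    then show ?thesis
      using P0 D0 \<beta>0 fA by (intro mult_left_mono add_mono mult_right_mono) auto
  qed
  also have "\<dots> = P * card A * (1 + (1 - \<beta>) * \<beta> ^ (h - 1) * D)"
    by (simp add: algebra_simps)
  also have "\<dots> \<le> P * card A * (1 + (1 - 1 / real h) ^ (h - 1) / real h * D)"
    using P0 D0 interior_maximum[OF \<beta>0 \<beta>1 h]
    by (intro mult_left_mono add_mono mult_right_mono) auto
  finally show ?thesis by (simp add: S_def P_def D_def)
qed

section \<open>Reduction to countable groups\<close>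

lemma (in group) countable_generate:
  assumes "H \<subseteq> carrier G" "countable H"
  shows "countable (generate G H)"
proof -
  define L where "L = H \<union> m_inv G ` H"
  define eval_word where "eval_word xs = foldr (\<otimes>) xs \<one>" for xs
  have L: "L \<subseteq> carrier G" using assms by (auto simp: L_def)
  have closed: "eval_word xs \<in> carrier G" if "xs \<in> lists L" for xs
    using that L by (induction xs) (auto simp: eval_word_def)
  have append: "eval_word (xs @ ys) = eval_word xs \<otimes> eval_word ys"
    if "xs \<in> lists L" "ys \<in> lists L" for xs ys
    using that(1)
  proof (induction xs)
    case Nil
    then show ?case using closed[OF that(2)] by (simp add: eval_word_def)
  next
    case (Cons x xs)
    then have "x \<in> carrier G" "eval_word xs \<in> carrier G" using L closed by auto
    then show ?case using Cons closed[OF that(2)] by (simp add: eval_word_def m_assoc)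
  qed
  have single: "x \<in> eval_word ` lists L" if "x \<in> L" for x
    using that L by (intro image_eqI[of _ _ "[x]"]) (auto simp: eval_word_def)
  have "generate G H \<subseteq> eval_word ` lists L"
  proof
    fix x assume "x \<in> generate G H"
    then show "x \<in> eval_word ` lists L"
    proof induction
      case one
      then show ?case by (intro image_eqI[of _ _ "[]"]) (auto simp: eval_word_def)
    next
      case (eng x y)
      then obtain xs ys where "xs \<in> lists L" "ys \<in> lists L" "x = eval_word xs" "y = eval_word ys" by auto
      then show ?case by (intro image_eqI[of _ _ "xs @ ys"]) (auto simp: append)
    next
      case (incl x)
      then show ?case by (intro single) (simp add: L_def)
    next
      case (inv x)
      then show ?case by (intro single) (simp add: L_def)
    qed
  qed
  moreover have "countable (lists L)" using assms by (simp add: L_def)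
  ultimately show ?thesis by (meson countable_image countable_subset)
qed

text \<open>
  The group structure on the image that makes an injective \<open>\<phi>\<close> an isomorphism.
\<close>
definition push_group :: "('a \<Rightarrow> 'b) \<Rightarrow> ('a, 'c) monoid_scheme \<Rightarrow> 'b monoid" where
  "push_group \<phi> G = \<lparr>carrier = \<phi> ` carrier G,
     monoid.mult = (\<lambda>x y. \<phi> (inv_into (carrier G) \<phi> x \<otimes>\<^bsub>G\<^esub> inv_into (carrier G) \<phi> y)),
     one = \<phi> \<one>\<^bsub>G\<^esub>\<rparr>"

lemma (in comm_group) comm_group_push_group:
  assumes inj: "inj_on \<phi> (carrier G)"
  shows "comm_group (push_group \<phi> G)"
proof (rule comm_groupI)
  fix x assume "x \<in> carrier (push_group \<phi> G)"
  then obtain a where "a \<in> carrier G" "x = \<phi> a" by (auto simp: push_group_def)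
  then show "\<exists>y\<in>carrier (push_group \<phi> G). y \<otimes>\<^bsub>push_group \<phi> G\<^esub> x = \<one>\<^bsub>push_group \<phi> G\<^esub>"
    using inj by (intro bexI[of _ "\<phi> (inv a)"]) (auto simp: push_group_def)
qed (use inj in \<open>auto simp: push_group_def m_ac\<close>)

lemma set_mult_push_group:
  assumes inj: "inj_on \<phi> (carrier G)" and "A \<subseteq> carrier G" "B \<subseteq> carrier G"
  shows "(\<phi> ` A) <#>\<^bsub>push_group \<phi> G\<^esub> (\<phi> ` B) = \<phi> ` (A <#>\<^bsub>G\<^esub> B)"
proof -
  have "\<phi> a \<otimes>\<^bsub>push_group \<phi> G\<^esub> \<phi> b = \<phi> (a \<otimes>\<^bsub>G\<^esub> b)" if "a \<in> A" "b \<in> B" for a b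
    using that assms by (simp add: push_group_def subset_iff)
  then show ?thesis unfolding set_mult_def by (auto simp: image_iff)
qed

lemma (in comm_group) prodset_push_group:
  assumes inj: "inj_on \<phi> (carrier G)" and "\<And>i. i \<in> {1..n} \<Longrightarrow> B i \<subseteq> carrier G"
  shows "prodset (push_group \<phi> G) (\<lambda>i. \<phi> ` B i) n = \<phi> ` prodset G B n"
  using assms(2)
proof (induction n)
  case 0
  show ?case by (simp add: push_group_def)
next
  case (Suc n)
  have "B (Suc n) \<subseteq> carrier G" by (rule Suc.prems) auto
  moreover have "B i \<subseteq> carrier G" if "i \<in> {1..n}" for i
    by (rule Suc.prems) (use that in auto)
  ultimately show ?case
    using Suc.IH prodset_carrier[of n B] inj by (simp add: set_mult_push_group)
qed

text \<open>
  The sets involved generate a countable subgroup, which an injection into the natural numbers copies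
  to a group of naturals; product sets keep their cardinalities under the copy.
\<close>
lemma sumset_bound_transfer:
  assumes bound: "sumset_bound TYPE(nat) h m\<^sub>0 F"
  shows "sumset_bound TYPE('a) h m\<^sub>0 F"
  unfolding sumset_bound_def
proof (intro allI impI)
  fix G :: "'a monoid" and m \<alpha> A B
  assume m: "m\<^sub>0 \<le> m" and hyps: "sumset_hyps G h m \<alpha> A B"
  interpret comm_group G using hyps by (simp add: sumset_hyps_def)
  define gens where "gens = A \<union> (\<Union>i\<in>{1..h}. B i)"
  have gens: "gens \<subseteq> carrier G" "finite gens"
    using hyps by (auto simp: gens_def sumset_hyps_def)
  define K where "K = generate G gens"
  have K: "subgroup K G" unfolding K_def by (rule generate_is_subgroup[OF gens(1)])
  have cK: "countable K" unfolding K_def using gens by (intro countable_generate countable_finite)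
  have gK: "gens \<subseteq> K" unfolding K_def by (auto intro: generate.incl)
  define H where "H = G\<lparr>carrier := K\<rparr>"
  interpret H: comm_group H unfolding H_def
  proof (rule group.group_comm_groupI[OF subgroup.subgroup_is_group[OF K is_group]])
    fix x y assume "x \<in> carrier (G\<lparr>carrier := K\<rparr>)" "y \<in> carrier (G\<lparr>carrier := K\<rparr>)"
    then have "x \<in> carrier G" "y \<in> carrier G" using subgroup.subset[OF K] by auto
    then show "x \<otimes>\<^bsub>G\<lparr>carrier := K\<rparr>\<^esub> y = y \<otimes>\<^bsub>G\<lparr>carrier := K\<rparr>\<^esub> x"
      by (simp add: m_comm)
  qed
  define \<phi> where "\<phi> = to_nat_on K"
  have inj: "inj_on \<phi> (carrier H)" using inj_on_to_nat_on[OF cK] by (simp add: H_def \<phi>_def)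
  interpret N: comm_group "push_group \<phi> H" by (rule H.comm_group_push_group[OF inj])
  have AK: "A \<subseteq> carrier H" and BK: "\<And>i. i \<in> {1..h} \<Longrightarrow> B i \<subseteq> carrier H"
  proof -
    have "carrier H = K" by (simp add: H_def)
    then show "A \<subseteq> carrier H" "\<And>i. i \<in> {1..h} \<Longrightarrow> B i \<subseteq> carrier H"
      using gK unfolding gens_def by blast+
  qed
  have mult: "U <#>\<^bsub>H\<^esub> V = U <#>\<^bsub>G\<^esub> V" for U V by (simp add: H_def set_mult_def)
  have card_image_mult: "card (\<phi> ` U <#>\<^bsub>push_group \<phi> H\<^esub> \<phi> ` V) = card (U <#>\<^bsub>G\<^esub> V)"
    if "U \<subseteq> carrier H" "V \<subseteq> carrier H" for U V
  proof -
    have "card (\<phi> ` (U <#>\<^bsub>H\<^esub> V)) = card (U <#>\<^bsub>H\<^esub> V)"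
      by (rule card_image) (rule inj_on_subset[OF inj H.set_mult_closed[OF that]])
    then show ?thesis by (simp add: set_mult_push_group[OF inj that] mult)
  qed
  have "sumset_hyps (push_group \<phi> H) h m \<alpha> (\<phi> ` A) (\<lambda>i. \<phi> ` B i)"
    unfolding sumset_hyps_def
  proof (intro conjI ballI)
    show "comm_group (push_group \<phi> H)" by (rule N.comm_group_axioms)
    show "card (\<phi> ` A) = m"
      using hyps inj_on_subset[OF inj AK] by (simp add: card_image sumset_hyps_def)
    fix i assume i: "i \<in> {1..h}"
    show "real (card (\<phi> ` A <#>\<^bsub>push_group \<phi> H\<^esub> \<phi> ` B i)) \<le> \<alpha> i * m"
      using hyps i unfolding card_image_mult[OF AK BK[OF i]] by (simp add: sumset_hyps_def)
    show "\<phi> ` B i \<subseteq> carrier (push_group \<phi> H)" using BK[OF i] by (auto simp: push_group_def)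
  qed (use hyps AK in \<open>auto simp: sumset_hyps_def push_group_def\<close>)
  then have "real (card (sumset_family (push_group \<phi> H) h (\<phi> ` A) (\<lambda>i. \<phi> ` B i)))
      \<le> (1 - 1 / real h) ^ (h - 1) / real h * (\<Prod>i=1..h. \<alpha> i) * F m"
    using bound m unfolding sumset_bound_def by blast
  moreover have "sumset_family (push_group \<phi> H) h (\<phi> ` A) (\<lambda>i. \<phi> ` B i)
      = \<phi> ` A <#>\<^bsub>push_group \<phi> H\<^esub> \<phi> ` prodset H B h"
  proof -
    have "\<phi> ` B i \<subseteq> carrier (push_group \<phi> H)" if "i \<in> {1..h}" for i
      using BK[OF that] by (auto simp: push_group_def)
    then have "sumset_family (push_group \<phi> H) h (\<phi> ` A) (\<lambda>i. \<phi> ` B i)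
      = \<phi> ` A <#>\<^bsub>push_group \<phi> H\<^esub> prodset (push_group \<phi> H) (\<lambda>i. \<phi> ` B i) h"
      by (rule N.sumset_family_eq)
    then show ?thesis using H.prodset_push_group[OF inj BK] by simp
  qed
  moreover have "prodset H B h = prodset G B h"
  proof -
    have "prodset H B n = prodset G B n" for n
      by (induction n) (simp_all add: mult, simp add: H_def)
    then show ?thesis .
  qed
  moreover have "sumset_family G h A B = A <#>\<^bsub>G\<^esub> prodset G B h"
    using hyps by (intro sumset_family_eq) (auto simp: sumset_hyps_def)
  moreover have "prodset H B h \<subseteq> carrier H" by (rule H.prodset_carrier) (rule BK)
  ultimately show "real (card (sumset_family G h A B))
      \<le> (1 - 1 / real h) ^ (h - 1) / real h * (\<Prod>i=1..h. \<alpha> i) * F m"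
    using card_image_mult[OF AK, of "prodset H B h"] by simp
qed

section \<open>The bound in terms of powers of m\<close>

text \<open>
  With \<open>M = m^(1/h)\<close> the leading term \<open>m M^(h-1)\<close> of the geometric sum is \<open>m^(2-1/h)\<close>.  The other
  \<open>h - 1\<close> terms and the summand \<open>m\<close> are each at most \<open>m M^(h-2) = m^(2-2/h)\<close>, for \<open>h \<ge> 2\<close>.
\<close>
lemma main_term_estimate:
  fixes c m :: real
  assumes h: "h \<ge> 2" and m: "m \<ge> 1" and c: "c > 0"
  shows "m * (1 + c * (\<Sum>j<h. (m powr (1 / h)) ^ j))
    \<le> c * (m powr (2 - 1 / h) + (real h - 1 + 1 / c) * m powr (2 - 2 / h))"
proof -
  define M where "M = m powr (1 / h)"
  have M: "M \<ge> 1" using m by (simp add: M_def ge_one_powr_ge_zero)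
  obtain n where n: "h = Suc (Suc n)" using h by (metis Suc_le_D numeral_2_eq_2 Suc_le_mono)
  have pow: "m * M ^ k = m powr (1 + k / h)" for k
    using m by (simp add: M_def powr_powr powr_add flip: powr_realpow)
  have "(\<Sum>j<Suc n. M ^ j) \<le> (\<Sum>j<Suc n. M ^ n)"
    using M by (intro sum_mono power_increasing) auto
  then have D: "(\<Sum>j<h. M ^ j) \<le> M ^ (n + 1) + (real h - 1) * M ^ n"
    by (simp add: n)
  have e1: "m * M ^ (n + 1) = m powr (2 - 1 / h)" unfolding pow
    by (simp add: n field_simps)
  have e2: "m * M ^ n = m powr (2 - 2 / h)" unfolding pow
    by (simp add: n field_simps)
  have "m * (1 + c * (\<Sum>j<h. M ^ j)) \<le> m * (M ^ n + c * (M ^ (n + 1) + (real h - 1) * M ^ n))"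
    using D M m c by (intro mult_left_mono add_mono) auto
  also have "\<dots> = c * (m * M ^ (n + 1) + (real h - 1 + 1 / c) * (m * M ^ n))"
    using c by (simp add: field_simps)
  finally show ?thesis unfolding e1 e2 by (simp only: M_def)
qed

lemma sumset_bound_with_error_term:
  assumes h: "h \<ge> 1"
  shows "\<exists>C>0. sumset_bound TYPE('a) h 1
    (\<lambda>m. real m powr (2 - 1 / real h) + C * real m powr (2 - 2 / real h))"
proof -
  define c where "c = (1 - 1 / real h) ^ (h - 1) / real h"
  have c: "c > 0"
  proof (cases "h = 1")
    case False
    then show ?thesis using h by (simp add: c_def)
  qed (simp add: c_def)
  define C where "C = real h - 1 + 1 / c"
  have "C > 0" unfolding C_def using c h by (simp add: add_nonneg_pos)
  moreover have "sumset_bound TYPE('a) h 1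
    (\<lambda>m. real m powr (2 - 1 / real h) + C * real m powr (2 - 2 / real h))"
    unfolding sumset_bound_def c_def[symmetric]
  proof (intro allI impI)
    fix G :: "'a monoid" and m \<alpha> A B
    assume m: "1 \<le> m" and hyps: "sumset_hyps G h m \<alpha> A B"
    interpret comm_group G using hyps by (simp add: sumset_hyps_def)
    define P where "P = (\<Prod>i=1..h. \<alpha> i)"
    have P: "P > 0" unfolding P_def using hyps by (intro prod_pos) (auto simp: sumset_hyps_def)
    have fam: "sumset_family G h A B = A <#>\<^bsub>G\<^esub> prodset G B h"
      using hyps by (intro sumset_family_eq) (auto simp: sumset_hyps_def)
    have "real (card (A <#>\<^bsub>G\<^esub> prodset G B h))
        \<le> P * c * (real m powr (2 - 1 / real h) + C * real m powr (2 - 2 / real h))"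
    proof (cases "h = 1")
      \<comment> \<open>The general estimate has the additional summand \<open>m\<close>, too large for the error term \<open>m^(2-2/h) = 1\<close>; the hypothesis itself is the bound.\<close>
      case True
      have B1: "B 1 \<subseteq> carrier G" using hyps True by (auto simp: sumset_hyps_def)
      then have "{\<one>\<^bsub>G\<^esub>} <#>\<^bsub>G\<^esub> B 1 = B 1" by (force simp: set_mult_def)
      then have "prodset G B h = B 1" using True by simp
      then have "real (card (A <#>\<^bsub>G\<^esub> prodset G B h)) \<le> P * m"
        using hyps True by (simp add: P_def sumset_hyps_def)
      also have "\<dots> \<le> P * (m + C)" using P \<open>C > 0\<close> by simp
      finally show ?thesis using True m by (simp add: c_def)
    next
      case False
      have "real (card (A <#>\<^bsub>G\<^esub> prodset G B h))
          \<le> P * card A * (1 + c * (\<Sum>j<h. (real m powr (1 / h)) ^ j))"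
        unfolding P_def c_def
      proof (rule product_set_bound)
        show "real m powr (1 / h) \<ge> 1" using m by (simp add: ge_one_powr_ge_zero)
        show "(real m powr (1 / h)) ^ h = card A"
          using m h hyps by (simp add: powr_powr sumset_hyps_def flip: powr_realpow)
      qed (use hyps h in \<open>auto simp: sumset_hyps_def\<close>)
      also have "\<dots> = P * (m * (1 + c * (\<Sum>j<h. (real m powr (1 / h)) ^ j)))"
        using hyps by (simp add: sumset_hyps_def)
      also have "\<dots> \<le> P * (c * (real m powr (2 - 1 / h) + (real h - 1 + 1 / c) * real m powr (2 - 2 / h)))"
        using main_term_estimate[of h "real m" c] False h m c P by (intro mult_left_mono) auto
      finally show ?thesis by (simp add: C_def mult.assoc)
    qed
    then show "real (card (sumset_family G h A B))
        \<le> c * (\<Prod>i=1..h. \<alpha> i) * (real m powr (2 - 1 / real h) + C * real m powr (2 - 2 / real h))"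
      unfolding fam P_def by (simp add: mult.commute)
  qed
  ultimately show ?thesis by blast
qed

theorem theorem1p3:
  fixes h :: nat
  assumes "h \<ge> 1"
  shows "(\<exists>C m\<^sub>0. C > 0 \<and>
            sumset_bound TYPE(nat) h m\<^sub>0
              (\<lambda>m. real m powr (2 - 1 / real h) + C * real m powr (2 - 2 / real h)) \<and>
            (\<exists>\<epsilon> :: nat \<Rightarrow> real. \<epsilon> \<longlonglongrightarrow> 0 \<and>
               sumset_bound TYPE(nat) h m\<^sub>0
                 (\<lambda>m. (1 + \<epsilon> m) * real m powr (2 - 1 / real h)))) \<and>
         (\<forall>m\<^sub>0 F. sumset_bound TYPE(nat) h m\<^sub>0 F \<longrightarrow> sumset_bound TYPE('a) h m\<^sub>0 F)"
proof (intro conjI allI impI)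
  obtain C where C: "C > 0" "sumset_bound TYPE(nat) h 1
      (\<lambda>m. real m powr (2 - 1 / real h) + C * real m powr (2 - 2 / real h))"
    using sumset_bound_with_error_term[OF assms] by blast
  define \<epsilon> where "\<epsilon> m = C * real m powr (- (1 / real h))" for m :: nat
  have "(\<lambda>m. C * real m powr (- (1 / real h))) \<longlonglongrightarrow> C * 0"
    using assms by (intro tendsto_mult tendsto_const tendsto_neg_powr filterlim_real_sequentially) auto
  then have "\<epsilon> \<longlonglongrightarrow> 0" by (simp add: \<epsilon>_def[abs_def])
  moreover have "(1 + \<epsilon> m) * real m powr (2 - 1 / real h)
      = real m powr (2 - 1 / real h) + C * real m powr (2 - 2 / real h)" for m
    by (simp add: \<epsilon>_def algebra_simps flip: powr_add)
  then have "sumset_bound TYPE(nat) h 1 (\<lambda>m. (1 + \<epsilon> m) * real m powr (2 - 1 / real h))"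
    using C(2) by simp
  ultimately show "\<exists>C m\<^sub>0. C > 0 \<and>
            sumset_bound TYPE(nat) h m\<^sub>0
              (\<lambda>m. real m powr (2 - 1 / real h) + C * real m powr (2 - 2 / real h)) \<and>
            (\<exists>\<epsilon> :: nat \<Rightarrow> real. \<epsilon> \<longlonglongrightarrow> 0 \<and>
               sumset_bound TYPE(nat) h m\<^sub>0
                 (\<lambda>m. (1 + \<epsilon> m) * real m powr (2 - 1 / real h)))"
    using C by blast
qed (rule sumset_bound_transfer)

end
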